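(* Let $\varphi$ be a CNF over $x_1,\dots,x_n$ with $|\varphi|$ clauses, let $\mu,\gamma,\beta\in[0,1]$ and $\delta\in(0,1)$, and put $w=\frac{2}{\beta}\ln\frac{4|\varphi|}{\gamma}$. Let $D$ be a distribution over $\{0,1\}^n$ with a width-$w$ $\left(\beta,1-\frac{\gamma\mu^w}{8n(2n+1)^w}\right)$ correlation gap, and suppose Algorithm CNF-Eval (described in the context) is given $\varphi,\delta,\gamma,\beta$ and independent partial assignments from $M_\mu(D)$. Given that either $\varphi$ is at least $(1-\frac{\gamma\mu^w}{8})$-valid under $D$ or $\varphi$ is at most $(1-\gamma)$-valid under $D$, Algorithm CNF-Eval decides which case holds (accepting in the first case and rejecting in the second) with probability $1-\delta$, in quasipolynomial time.
   Context: A clause is a disjunction of literals, its width is its number of literals; a CNF is a conjunction of clauses. $\varphi$ is $(1-\epsilon)$-valid under $D$ if $\Pr_{x\sim D}[\varphi(x)=1]\ge1-\epsilon$; it is at most $(1-\gamma)$-valid if this probability is at most $1-\gamma$. Correlation gap: $D$ has a width-$w$ $(\beta,1-\gamma')$ correlation gap if for every conjunction of $k\le w$ literals $\ell_1\wedge\cdots\wedge\ell_k$ with nonzero probability under $D$ and every variable $x$, either $\Pr[x=1\mid\ell_1\wedge\cdots\wedge\ell_k]\ge\beta$ and $\Pr[x=0\mid\ell_1\wedge\cdots\wedge\ell_k]\ge\beta$, or for some $b\in\{0,1\}$, $\Pr[x=b\mid\ell_1\wedge\cdots\wedge\ell_k]\ge1-\gamma'$. Masking: a partial assignment is $\rho\in\{0,1,*\}^n$;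 $M_\mu$ maps $x$ to $\rho$ with $\rho_i=x_i$ independently with probability $\mu$ and $\rho_i=*$ otherwise; $M_\mu(D)$ is the distribution of $M_\mu(x)$, $x\sim D$. A clause is witnessed to evaluate to false on $\rho$ if every literal $\ell(x_i)$ of it has $\rho_i\ne*$ and $\ell(\rho_i)=0$. Algorithm CNF-Eval: input $\varphi,\delta,\gamma,\beta$ and partial assignments $\rho^{(1)},\dots,\rho^{(m_0+m_1)}$ from $M_\mu(D)$, with $m_0=\frac{32w(2n+1)^{2w}}{\mu^{4w}\gamma^2}\ln\frac{4n+2}{\delta}$ and $m_1=\frac{32}{(\mu^w\gamma)^2}\ln\frac{2}{\delta}$. (i) Let $\psi$ be the conjunction of all clauses of width at most $w$ witnessed to evaluate to false on at most $\frac{\gamma\mu^{2w}}{4(2n+1)^w}m_0$ of $\rho^{(1)},\dots,\rho^{(m_0)}$. (ii) For each clause $C$ of $\varphi$: for each clause $C'$ of $\psi$ in turn, if $C'=C''\vee\ell$ where $C''\vee\neg\ell$ is a subclause of (the current) $C$, delete $\neg\ell$ from $C$; add the resulting $C$ to a CNF $\varphi'$. (iii) For $i=m_0+1,\dots,m_0+m_1$, count the $i$ for which some clause of $\varphi'$ is witnessed to evaluate to false on $\rho^{(i)}$; as soon as the count exceeds $(5\mu^w\gamma/8)m_1$, output Reject. If the loop finishes, output Accept.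
   Formalization: w is rounded up to an integer, used in every formula (for fractional w the claim can fail); m_0, m_1 are rounded up; μ, γ, β are positive and φ nonempty; in C'=C''∨ℓ neither ℓ nor ¬ℓ lies in C''; time is unit-cost steps, at most exp((c/β)(ln N)^k), with N = 2+n+size(φ)+1/μ+1/γ+ln(1/δ). *)

theory Defs
  imports "HOL-Probability.Probability" "HOL-Library.Monad_Syntax"
begin

subsection \<open>Formulas and distributions\<close>

text \<open>Variables are indexed from 0. Points of \<open>{0,1}\<^sup>n\<close> are functions that are \<open>False\<close> from
  index \<open>n\<close> on; partial assignments have the value \<open>None\<close> for the symbol \<open>*\<close>.\<close>

datatype literal = Pos nat | Neg nat

type_synonym clause = "literal list"
type_synonym cnf = "clause list"
type_synonym assignment = "nat \<Rightarrow> bool"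
type_synonym partial_assignment = "nat \<Rightarrow> bool option"

fun neg :: "literal \<Rightarrow> literal" where
  "neg (Pos i) = Neg i"
| "neg (Neg i) = Pos i"

fun lit_true :: "assignment \<Rightarrow> literal \<Rightarrow> bool" where
  "lit_true x (Pos i) \<longleftrightarrow> x i"
| "lit_true x (Neg i) \<longleftrightarrow> \<not> x i"

definition clause_true :: "assignment \<Rightarrow> clause \<Rightarrow> bool" where
  "clause_true x C \<longleftrightarrow> (\<exists>l\<in>set C. lit_true x l)"

definition cnf_true :: "assignment \<Rightarrow> cnf \<Rightarrow> bool" where
  "cnf_true x \<phi> \<longleftrightarrow> (\<forall>C\<in>set \<phi>. clause_true x C)"

definition literals :: "nat \<Rightarrow> literal set" where
  "literals n = Pos ` {..<n} \<union> Neg ` {..<n}"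

definition cnf_over :: "nat \<Rightarrow> cnf \<Rightarrow> bool" where
  "cnf_over n \<phi> \<longleftrightarrow> (\<forall>C\<in>set \<phi>. set C \<subseteq> literals n)"

definition cnf_size :: "cnf \<Rightarrow> nat" where
  "cnf_size \<phi> = length \<phi> + (\<Sum>C\<leftarrow>\<phi>. length C)"

definition cube :: "nat \<Rightarrow> assignment set" where
  "cube n = PiE_dflt {..<n} False (\<lambda>_. UNIV)"

definition validity :: "assignment pmf \<Rightarrow> cnf \<Rightarrow> real" where
  "validity D \<phi> = measure_pmf.prob D {x. cnf_true x \<phi>}"

definition correlation_gap :: "nat \<Rightarrow> assignment pmf \<Rightarrow> nat \<Rightarrow> real \<Rightarrow> real \<Rightarrow> bool" where
  "correlation_gap n D w \<beta> q \<longleftrightarrow>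
     (\<forall>L i. set L \<subseteq> literals n \<and> length L \<le> w \<and> i < n \<and>
        measure_pmf.prob D {x. \<forall>l\<in>set L. lit_true x l} \<noteq> 0 \<longrightarrow>
        (\<forall>b. cond_prob (measure_pmf D) (\<lambda>x. x i = b) (\<lambda>x. \<forall>l\<in>set L. lit_true x l) \<ge> \<beta>) \<or>
        (\<exists>b. cond_prob (measure_pmf D) (\<lambda>x. x i = b) (\<lambda>x. \<forall>l\<in>set L. lit_true x l) \<ge> q))"

definition mask :: "nat \<Rightarrow> real \<Rightarrow> assignment \<Rightarrow> partial_assignment pmf" where
  "mask n \<mu> x = Pi_pmf {..<n} None
     (\<lambda>i. map_pmf (\<lambda>revealed. if revealed then Some (x i) else None) (bernoulli_pmf \<mu>))"

definition masked :: "nat \<Rightarrow> real \<Rightarrow> assignment pmf \<Rightarrow> partial_assignment pmf" where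
  "masked n \<mu> D = bind_pmf D (mask n \<mu>)"

fun lit_witnessed_false :: "partial_assignment \<Rightarrow> literal \<Rightarrow> bool" where
  "lit_witnessed_false \<rho> (Pos i) \<longleftrightarrow> \<rho> i = Some False"
| "lit_witnessed_false \<rho> (Neg i) \<longleftrightarrow> \<rho> i = Some True"


subsection \<open>Computations with a step count\<close>

text \<open>Cost model: one step for each call of a list function below on one list cell, for each
  comparison of literals, for each evaluation of a literal on a partial assignment, and for each
  operation on or comparison of real numbers.\<close>

datatype 'a timed = Timed (result: 'a) (steps: nat)

definition ret :: "'a \<Rightarrow> 'a timed" where
  "ret a = Timed a 0"

definition tick :: "'a timed \<Rightarrow> 'a timed" where
  "tick t = Timed (result t) (Suc (steps t))"

definition bind_timed :: "'a timed \<Rightarrow> ('a \<Rightarrow> 'b timed) \<Rightarrow> 'b timed" where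
  "bind_timed t f = Timed (result (f (result t))) (steps t + steps (f (result t)))"

adhoc_overloading Monad_Syntax.bind \<rightleftharpoons> bind_timed

fun length_t :: "'a list \<Rightarrow> nat timed" where
  "length_t [] = tick (ret 0)"
| "length_t (a # as) = tick (do { k \<leftarrow> length_t as; ret (Suc k) })"

fun append_t :: "'a list \<Rightarrow> 'a list \<Rightarrow> 'a list timed" where
  "append_t [] bs = tick (ret bs)"
| "append_t (a # as) bs = tick (do { cs \<leftarrow> append_t as bs; ret (a # cs) })"

fun split_t :: "nat \<Rightarrow> 'a list \<Rightarrow> ('a list \<times> 'a list) timed" where
  "split_t 0 as = tick (ret ([], as))"
| "split_t (Suc k) [] = tick (ret ([], []))"
| "split_t (Suc k) (a # as) = tick (do { p \<leftarrow> split_t k as; ret (a # fst p, snd p) })"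

fun map_t :: "('a \<Rightarrow> 'b timed) \<Rightarrow> 'a list \<Rightarrow> 'b list timed" where
  "map_t f [] = tick (ret [])"
| "map_t f (a # as) = tick (do { b \<leftarrow> f a; bs \<leftarrow> map_t f as; ret (b # bs) })"

fun filter_t :: "('a \<Rightarrow> bool timed) \<Rightarrow> 'a list \<Rightarrow> 'a list timed" where
  "filter_t P [] = tick (ret [])"
| "filter_t P (a # as) =
     tick (do { p \<leftarrow> P a; bs \<leftarrow> filter_t P as; ret (if p then a # bs else bs) })"

fun count_t :: "('a \<Rightarrow> bool timed) \<Rightarrow> 'a list \<Rightarrow> nat timed" where
  "count_t P [] = tick (ret 0)"
| "count_t P (a # as) =
     tick (do { p \<leftarrow> P a; k \<leftarrow> count_t P as; ret (if p then Suc k else k) })"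

fun all_t :: "('a \<Rightarrow> bool timed) \<Rightarrow> 'a list \<Rightarrow> bool timed" where
  "all_t P [] = tick (ret True)"
| "all_t P (a # as) = tick (do { p \<leftarrow> P a; if p then all_t P as else ret False })"

fun ex_t :: "('a \<Rightarrow> bool timed) \<Rightarrow> 'a list \<Rightarrow> bool timed" where
  "ex_t P [] = tick (ret False)"
| "ex_t P (a # as) = tick (do { p \<leftarrow> P a; if p then ret True else ex_t P as })"

fun fold_t :: "('a \<Rightarrow> 'b \<Rightarrow> 'b timed) \<Rightarrow> 'a list \<Rightarrow> 'b \<Rightarrow> 'b timed" where
  "fold_t f [] s = tick (ret s)"
| "fold_t f (a # as) s = tick (do { s' \<leftarrow> f a s; fold_t f as s' })"


subsection \<open>The algorithm\<close>

datatype verdict = Accept | Reject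

definition mem_t :: "literal \<Rightarrow> clause \<Rightarrow> bool timed" where
  "mem_t l C = ex_t (\<lambda>l'. tick (ret (l' = l))) C"

definition delete_t :: "literal \<Rightarrow> clause \<Rightarrow> clause timed" where
  "delete_t l C = filter_t (\<lambda>l'. tick (ret (l' \<noteq> l))) C"

definition witnessed_false_t :: "partial_assignment \<Rightarrow> clause \<Rightarrow> bool timed" where
  "witnessed_false_t \<rho> C = all_t (\<lambda>l. tick (ret (lit_witnessed_false \<rho> l))) C"

fun literals_t :: "nat \<Rightarrow> literal list timed" where
  "literals_t 0 = tick (ret [])"
| "literals_t (Suc n) = tick (do { ls \<leftarrow> literals_t n; ret (Pos n # Neg n # ls) })"

text \<open>Every clause with at most \<open>w\<close> literals from a given list of distinct literals, each listed
  once.\<close>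

fun clauses_t :: "nat \<Rightarrow> literal list \<Rightarrow> cnf timed" where
  "clauses_t w [] = tick (ret [[]])"
| "clauses_t 0 (l # ls) = tick (ret [[]])"
| "clauses_t (Suc w) (l # ls) = tick (do {
     with_l \<leftarrow> clauses_t w ls;
     with_l \<leftarrow> map_t (\<lambda>C. tick (ret (l # C))) with_l;
     without_l \<leftarrow> clauses_t (Suc w) ls;
     append_t with_l without_l })"

definition learn_t :: "nat \<Rightarrow> nat \<Rightarrow> real \<Rightarrow> partial_assignment list \<Rightarrow> cnf timed" where
  "learn_t n w threshold \<rho>s = do {
     ls \<leftarrow> literals_t n;
     Cs \<leftarrow> clauses_t w ls;
     filter_t (\<lambda>C. do {
       k \<leftarrow> count_t (\<lambda>\<rho>. witnessed_false_t \<rho> C) \<rho>s;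
       tick (ret (real k \<le> threshold)) }) Cs }"

text \<open>Writing \<open>C' = C'' \<or> l\<close> means that neither \<open>l\<close> nor its negation occurs in \<open>C''\<close>. The second
  part is essential: a tautology \<open>neg l \<or> l\<close> would otherwise delete \<open>neg l\<close> from any clause.\<close>

definition reduce_by_t :: "clause \<Rightarrow> clause \<Rightarrow> clause timed" where
  "reduce_by_t C' C = fold_t (\<lambda>l C. do {
     C'' \<leftarrow> delete_t l C';
     taut \<leftarrow> mem_t (neg l) C'';
     sub \<leftarrow> all_t (\<lambda>l'. mem_t l' C) (neg l # C'');
     if \<not> taut \<and> sub then delete_t (neg l) C else ret C }) C' C"

definition reduce_t :: "cnf \<Rightarrow> clause \<Rightarrow> clause timed" where
  "reduce_t \<psi> C = fold_t reduce_by_t \<psi> C"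

fun test_t :: "cnf \<Rightarrow> real \<Rightarrow> nat \<Rightarrow> partial_assignment list \<Rightarrow> verdict timed" where
  "test_t \<phi>' threshold k [] = tick (ret Accept)"
| "test_t \<phi>' threshold k (\<rho> # \<rho>s) = tick (do {
     falsified \<leftarrow> ex_t (witnessed_false_t \<rho>) \<phi>';
     k' \<leftarrow> ret (if falsified then Suc k else k);
     exceeded \<leftarrow> tick (ret (real k' > threshold));
     if exceeded then ret Reject else test_t \<phi>' threshold k' \<rho>s })"

text \<open>The width is the integer \<open>w\<close>, rounded up, and this integer is used in all bounds; sample
  sizes are rounded up as well.\<close>

definition eval_width :: "nat \<Rightarrow> real \<Rightarrow> real \<Rightarrow> nat" where
  "eval_width m \<gamma> \<beta> = nat \<lceil>2 / \<beta> * ln (4 * real m / \<gamma>)\<rceil>"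

definition learn_samples :: "nat \<Rightarrow> nat \<Rightarrow> real \<Rightarrow> real \<Rightarrow> real \<Rightarrow> nat" where
  "learn_samples n w \<mu> \<gamma> \<delta> =
     nat \<lceil>32 * real w * (2 * real n + 1) ^ (2 * w) / (\<mu> ^ (4 * w) * \<gamma>\<^sup>2)
            * ln ((4 * real n + 2) / \<delta>)\<rceil>"

definition test_samples :: "nat \<Rightarrow> real \<Rightarrow> real \<Rightarrow> real \<Rightarrow> nat" where
  "test_samples w \<mu> \<gamma> \<delta> = nat \<lceil>32 / (\<mu> ^ w * \<gamma>)\<^sup>2 * ln (2 / \<delta>)\<rceil>"

definition cnf_eval ::
  "nat \<Rightarrow> real \<Rightarrow> cnf \<Rightarrow> real \<Rightarrow> real \<Rightarrow> real \<Rightarrow> partial_assignment list \<Rightarrow> verdict timed" where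
  "cnf_eval n \<mu> \<phi> \<delta> \<gamma> \<beta> \<rho>s = do {
     m \<leftarrow> length_t \<phi>;
     w \<leftarrow> tick (ret (eval_width m \<gamma> \<beta>));
     m\<^sub>0 \<leftarrow> tick (ret (learn_samples n w \<mu> \<gamma> \<delta>));
     m\<^sub>1 \<leftarrow> tick (ret (test_samples w \<mu> \<gamma> \<delta>));
     \<theta>\<^sub>0 \<leftarrow> tick (ret (\<gamma> * \<mu> ^ (2 * w) / (4 * (2 * real n + 1) ^ w) * real m\<^sub>0));
     \<theta>\<^sub>1 \<leftarrow> tick (ret (5 * \<mu> ^ w * \<gamma> / 8 * real m\<^sub>1));
     parts \<leftarrow> split_t m\<^sub>0 \<rho>s;
     \<psi> \<leftarrow> learn_t n w \<theta>\<^sub>0 (fst parts);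
     \<phi>' \<leftarrow> map_t (reduce_t \<psi>) \<phi>;
     tests \<leftarrow> split_t m\<^sub>1 (snd parts);
     test_t \<phi>' \<theta>\<^sub>1 0 (fst tests) }"

end

theory Submission
  imports Defs
begin

text \<open>
  By Hoeffding's inequality and a union bound over the at most \<open>(2n+1)\<^sup>w\<close> clauses of width at most
  \<open>w\<close>, the learned CNF \<open>\<psi>\<close> is false with probability at most \<open>3\<gamma>\<mu>\<^sup>w/8\<close>, and it contains every clause
  that is witnessed false with probability at most half the threshold. Each deletion is a resolution
  step, so \<open>\<phi> \<and> \<psi>\<close> implies \<open>\<phi>'\<close>, while \<open>\<phi>'\<close> implies \<open>\<phi>\<close>; the first fact yields acceptance.

  For rejection, take a clause of \<open>\<phi>'\<close> with more than \<open>w\<close> literals and condition successively on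
  its literals being false. By the correlation gap each further literal is balanced, or nearly always
  true, or nearly always false. The last case is impossible, as a learned clause would have deleted the
  literal. If the first \<open>w\<close> literals are all balanced, the clause is false with probability at most
  \<open>(1-\<beta>)\<^sup>w \<le> (\<gamma>/4|\<phi>|)\<^sup>2\<close>. Otherwise some subclause of width at most \<open>w\<close> is nearly always
  true, and a union bound over all clauses of that width covers these. Hence narrow
  clauses of \<open>\<phi>'\<close> account for false probability at least \<open>3\<gamma>/4\<close>, and a narrow false clause is witnessed with probability at least \<open>\<mu>\<^sup>w\<close>.
\<close>

subsection \<open>Results of the timed computations\<close>

lemma timed_simps [simp]:
  "result (ret a) = a" "steps (ret a) = 0"
  "result (tick t) = result t" "steps (tick t) = Suc (steps t)"
  "result (bind_timed t f) = result (f (result t))"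
  "steps (bind_timed t f) = steps t + steps (f (result t))"
  by (simp_all add: ret_def tick_def bind_timed_def)

lemma result_list_ops [simp]:
  shows result_length_t: "result (length_t as) = length as"
    and result_append_t: "result (append_t as bs) = as @ bs"
    and result_map_t: "result (map_t f as) = map (\<lambda>a. result (f a)) as"
    and result_filter_t: "result (filter_t P as) = filter (\<lambda>a. result (P a)) as"
    and result_count_t: "result (count_t P as) = length (filter (\<lambda>a. result (P a)) as)"
    and result_all_t: "result (all_t P as) \<longleftrightarrow> (\<forall>a\<in>set as. result (P a))"
    and result_ex_t: "result (ex_t P as) \<longleftrightarrow> (\<exists>a\<in>set as. result (P a))"
  by (induction as) auto

lemma result_split_t [simp]: "result (split_t k as) = (take k as, drop k as)"
  by (induction k as rule: split_t.induct) auto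

lemma result_fold_t [simp]: "result (fold_t f as s) = fold (\<lambda>a s. result (f a s)) as s"
  by (induction as arbitrary: s) auto

lemma result_mem_t [simp]: "result (mem_t l C) \<longleftrightarrow> l \<in> set C"
  by (auto simp: mem_t_def)

lemma result_delete_t [simp]: "result (delete_t l C) = removeAll l C"
  by (simp add: delete_t_def removeAll_filter_not_eq eq_commute)

definition witnessed_false :: "partial_assignment \<Rightarrow> clause \<Rightarrow> bool" where
  "witnessed_false \<rho> C \<longleftrightarrow> (\<forall>l\<in>set C. lit_witnessed_false \<rho> l)"

lemma result_witnessed_false_t [simp]:
  "result (witnessed_false_t \<rho> C) = witnessed_false \<rho> C"
  by (simp add: witnessed_false_t_def witnessed_false_def)

lemma set_result_literals_t [simp]: "set (result (literals_t n)) = literals n"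
  by (induction n) (auto simp: literals_def lessThan_Suc)

lemma length_result_literals_t [simp]: "length (result (literals_t n)) = 2 * n"
  by (induction n) auto

lemma distinct_result_literals_t: "distinct (result (literals_t n))"
  by (induction n) (auto simp: literals_def)

section \<open>Enumeration of the narrow clauses\<close>

lemma clauses_t_sound:
  "C \<in> set (result (clauses_t w ls)) \<Longrightarrow> length C \<le> w \<and> set C \<subseteq> set ls"
proof (induction w ls arbitrary: C rule: clauses_t.induct)
  case (3 w l ls)
  then show ?case by (fastforce)
qed auto

text \<open>Order and repetition of literals carry no meaning, so the target is a set. The induction
  follows the recursion: a target containing \<open>l\<close> spends one unit of width on it, and
  any other target already lies in the tail.\<close>

lemma clauses_t_complete:
  assumes "A \<subseteq> set ls" "card A \<le> w" "distinct ls"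
  shows "\<exists>C\<in>set (result (clauses_t w ls)). set C = A"
  using assms
proof (induction w ls arbitrary: A rule: clauses_t.induct)
  case (2 l ls)
  then have "A = {}" by (meson card_0_eq finite_set finite_subset le_zero_eq)
  then show ?case by simp
next
  case (3 w l ls)
  show ?case
  proof (cases "l \<in> A")
    case True
    have "finite A" using "3.prems" by (meson finite_set finite_subset)
    then have "card (A - {l}) \<le> w" using True "3.prems" by simp
    moreover have "A - {l} \<subseteq> set ls" using "3.prems" by auto
    moreover have "distinct ls" using "3.prems" by simp
    ultimately obtain C where "C \<in> set (result (clauses_t w ls))" "set C = A - {l}"
      by (meson "3.IH"(1))
    then have "l # C \<in> set (result (clauses_t (Suc w) (l # ls)))" "set (l # C) = A"
      using True by auto
    then show ?thesis by blast
  next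
    case False
    then have "A \<subseteq> set ls" using "3.prems" by auto
    moreover have "distinct ls" using "3.prems" by simp
    ultimately obtain C where "C \<in> set (result (clauses_t (Suc w) ls))" "set C = A"
      by (meson "3.IH"(2) "3.prems"(2))
    then show ?thesis by auto
  qed
qed auto

text \<open>Heuristically, each of \<open>w\<close> slots holds a literal or stays empty. The
  recursion closes because \<open>?N ^ w + ?N ^ Suc w = (?N + 1) * ?N ^ w\<close>.\<close>

lemma length_result_clauses_t: "length (result (clauses_t w ls)) \<le> (length ls + 1) ^ w"
proof (induction w ls rule: clauses_t.induct)
  case (3 w l ls)
  let ?N = "length ls + 1"
  have "length (result (clauses_t (Suc w) (l # ls))) \<le> ?N ^ w + ?N ^ Suc w"
    using 3 by (simp add: add_mono)
  also have "\<dots> = (?N + 1) * ?N ^ w" by (simp add: algebra_simps)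
  also have "\<dots> \<le> (?N + 1) * (?N + 1) ^ w" by (intro mult_left_mono power_mono) auto
  finally show ?case by simp
qed auto

definition narrow_clauses :: "nat \<Rightarrow> nat \<Rightarrow> cnf" where
  "narrow_clauses n w = result (clauses_t w (result (literals_t n)))"

lemma narrow_clausesD:
  assumes "C \<in> set (narrow_clauses n w)"
  shows "length C \<le> w" "set C \<subseteq> literals n"
  using clauses_t_sound[of C w "result (literals_t n)"] assms by (auto simp: narrow_clauses_def)

lemma ex_narrow_clause:
  "A \<subseteq> literals n \<Longrightarrow> card A \<le> w \<Longrightarrow> \<exists>C\<in>set (narrow_clauses n w). set C = A"
  unfolding narrow_clauses_def
  by (intro clauses_t_complete) (auto simp: distinct_result_literals_t)

lemma length_narrow_clauses: "length (narrow_clauses n w) \<le> (2 * n + 1) ^ w"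
  using length_result_clauses_t[of w "result (literals_t n)"] by (simp add: narrow_clauses_def)

definition false_count :: "partial_assignment list \<Rightarrow> clause \<Rightarrow> nat" where
  "false_count \<rho>s C = length (filter (\<lambda>\<rho>. witnessed_false \<rho> C) \<rho>s)"

lemma result_learn_t:
  "result (learn_t n w \<theta> \<rho>s) = filter (\<lambda>C. real (false_count \<rho>s C) \<le> \<theta>) (narrow_clauses n w)"
  by (simp add: learn_t_def narrow_clauses_def false_count_def)

section \<open>Deletion of literals as resolution\<close>

definition reduce_step :: "clause \<Rightarrow> literal \<Rightarrow> clause \<Rightarrow> clause" where
  "reduce_step C' l C =
     (if neg l \<notin> set C' - {l} \<and> insert (neg l) (set C' - {l}) \<subseteq> set C
      then removeAll (neg l) C else C)"

definition reduce_by :: "clause \<Rightarrow> clause \<Rightarrow> clause" where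
  "reduce_by C' = fold (reduce_step C') C'"

definition reduce :: "cnf \<Rightarrow> clause \<Rightarrow> clause" where
  "reduce \<psi> = fold reduce_by \<psi>"

lemma result_reduce_by_t [simp]: "result (reduce_by_t C' C) = reduce_by C' C"
proof -
  have "(\<lambda>l C. result (do {
     C'' \<leftarrow> delete_t l C';
     taut \<leftarrow> mem_t (neg l) C'';
     sub \<leftarrow> all_t (\<lambda>l'. mem_t l' C) (neg l # C'');
     if \<not> taut \<and> sub then delete_t (neg l) C else ret C })) = reduce_step C'"
    by (intro ext) (auto simp: reduce_step_def)
  then show ?thesis by (simp add: reduce_by_t_def reduce_by_def)
qed

lemma result_reduce_t [simp]: "result (reduce_t \<psi> C) = reduce \<psi> C"
  by (simp add: reduce_t_def reduce_def)

lemma neg_neg [simp]: "neg (neg l) = l"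
  by (cases l) auto

lemma neg_neq [simp]: "neg l \<noteq> l"
  by (cases l) auto

lemma lit_true_neg [simp]: "lit_true x (neg l) \<longleftrightarrow> \<not> lit_true x l"
  by (cases l) auto

lemma neg_in_literals [simp]: "neg l \<in> literals n \<longleftrightarrow> l \<in> literals n"
  by (cases l) (auto simp: literals_def)

text \<open>Inclusion of literal sets serves the truth arguments and the bound on list length serves
  the step counts, so both are carried along.\<close>

lemma fold_shrinks:
  assumes "\<And>a s. set (f a s) \<subseteq> set s \<and> length (f a s) \<le> length s"
  shows "set (fold f as s) \<subseteq> set s \<and> length (fold f as s) \<le> length s"
proof (induction as arbitrary: s)
  case (Cons a as)
  show ?case using Cons[of "f a s"] assms[of a s] by auto
qed auto

lemma reduce_step_shrinks:
  "set (reduce_step C' l C) \<subseteq> set C \<and> length (reduce_step C' l C) \<le> length C"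
  by (auto simp: reduce_step_def)

lemma reduce_by_shrinks: "set (reduce_by C' C) \<subseteq> set C \<and> length (reduce_by C' C) \<le> length C"
  unfolding reduce_by_def by (intro fold_shrinks reduce_step_shrinks)

lemma reduce_shrinks: "set (reduce \<psi> C) \<subseteq> set C \<and> length (reduce \<psi> C) \<le> length C"
  unfolding reduce_def by (intro fold_shrinks reduce_by_shrinks)

text \<open>Suppose \<open>neg l\<close> is deleted. If \<open>l\<close> is false, the true literal
  of \<open>C'\<close> differs from \<open>l\<close>, hence lies in \<open>C\<close>, and it
  survives because the tautology check ensures that it is not \<open>neg l\<close>. If
  \<open>l\<close> is true, the true literal of \<open>C\<close> is not the deleted one.\<close>

lemma reduce_step_true:
  assumes "clause_true x C'" "clause_true x C"
  shows "clause_true x (reduce_step C' l C)"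
  using assms by (force simp: reduce_step_def clause_true_def)

lemma reduce_by_true:
  assumes "clause_true x C'" "clause_true x C"
  shows "clause_true x (reduce_by C' C)"
proof -
  have "clause_true x (fold (reduce_step C') ls C)" for ls
    using assms(2) by (induction ls arbitrary: C) (auto simp: reduce_step_true assms(1))
  then show ?thesis by (simp add: reduce_by_def)
qed

lemma reduce_true:
  "cnf_true x \<psi> \<Longrightarrow> clause_true x C \<Longrightarrow> clause_true x (reduce \<psi> C)"
  unfolding reduce_def
  by (induction \<psi> arbitrary: C) (auto simp: cnf_true_def reduce_by_true)

lemma reduce_false: "\<not> clause_true x C \<Longrightarrow> \<not> clause_true x (reduce \<psi> C)"
  using reduce_shrinks[of \<psi> C] by (auto simp: clause_true_def)

text \<open>A single pass suffices: the current clause only shrinks, so a deletion that is possible for the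
  final clause was possible when its turn came.\<close>

lemma fold_removes:
  assumes shrinks: "\<And>a s. set (f a s) \<subseteq> set s"
    and a: "a \<in> set as"
    and step: "\<And>s. B \<subseteq> set (f a s) \<Longrightarrow> l \<notin> set (f a s)"
    and B: "B \<subseteq> set (fold f as s)"
  shows "l \<notin> set (fold f as s)"
proof -
  have sub: "set (fold f xs s) \<subseteq> set s" for xs s
    using shrinks by (induction xs arbitrary: s) force+
  obtain us vs where "as = us @ a # vs" using a by (meson split_list)
  then have "set (fold f as s) \<subseteq> set (f a (fold f us s))" using sub by simp
  then show ?thesis using B step by blast
qed

text \<open>If \<open>neg l\<close> survived, the final clause would contain the whole set
  \<open>?B\<close> whose presence makes the step on pivot \<open>l\<close> with \<open>C'\<close>
  fire. The passes over \<open>C'\<close> and over \<open>\<psi>\<close> are nested, so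
  \<open>fold_removes\<close> is used once for each.\<close>

lemma reduce_saturated:
  assumes "C' \<in> set \<psi>" "l \<in> set C'" "neg l \<notin> set C'" "set C' - {l} \<subseteq> set (reduce \<psi> C)"
  shows "neg l \<notin> set (reduce \<psi> C)"
proof
  assume "neg l \<in> set (reduce \<psi> C)"
  then have B: "insert (neg l) (set C' - {l}) \<subseteq> set (reduce \<psi> C)" (is "?B \<subseteq> _")
    using assms(4) by simp
  have step: "neg l \<notin> set (reduce_step C' l s)" if "?B \<subseteq> set (reduce_step C' l s)" for s
  proof -
    have "?B \<subseteq> set s" using that reduce_step_shrinks[of C' l s] by (meson order_trans)
    then have "reduce_step C' l s = removeAll (neg l) s"
      using assms(3) by (simp add: reduce_step_def)
    then show ?thesis by simp
  qed
  have by_clause: "neg l \<notin> set (reduce_by C' s)" if "?B \<subseteq> set (reduce_by C' s)" for s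
    using fold_removes[of "reduce_step C'" l C' ?B "neg l" s] that step assms(2)
      reduce_step_shrinks unfolding reduce_by_def by metis
  have "neg l \<notin> set (reduce \<psi> C)"
    using fold_removes[of reduce_by C' \<psi> ?B "neg l" C] B by_clause assms(1)
      reduce_by_shrinks unfolding reduce_def by metis
  then show False using \<open>neg l \<in> _\<close> by simp
qed

definition falsified :: "cnf \<Rightarrow> partial_assignment \<Rightarrow> bool" where
  "falsified \<phi> \<rho> \<longleftrightarrow> (\<exists>C\<in>set \<phi>. witnessed_false \<rho> C)"

text \<open>Stopping early does not alter the verdict, as the count only grows. The premise is the
  loop invariant: the comparison comes after a sample has been read, so accepting on the empty list
  is right only while the count has not exceeded the threshold.\<close>

lemma result_test_t:
  assumes "real k \<le> \<theta>"
  shows "result (test_t \<phi> \<theta> k \<rho>s) =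
    (if real (k + length (filter (falsified \<phi>) \<rho>s)) > \<theta> then Reject else Accept)"
  using assms
proof (induction \<rho>s arbitrary: k)
  case (Cons \<rho> \<rho>s)
  show ?case
    using Cons.IH[of k] Cons.IH[of "Suc k"] Cons.prems
    by (auto simp: falsified_def not_less)
qed auto

definition learned :: "nat \<Rightarrow> nat \<Rightarrow> real \<Rightarrow> real \<Rightarrow> real \<Rightarrow> partial_assignment list \<Rightarrow> cnf" where
  "learned n w \<mu> \<gamma> \<delta> \<rho>s =
     filter (\<lambda>C. real (false_count \<rho>s C)
         \<le> \<gamma> * \<mu> ^ (2 * w) / (4 * (2 * real n + 1) ^ w) * real (learn_samples n w \<mu> \<gamma> \<delta>))
       (narrow_clauses n w)"

lemma result_cnf_eval:
  fixes \<rho>s \<sigma>s :: "partial_assignment list"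
  assumes "0 \<le> \<mu>" "0 \<le> \<gamma>"
    and w: "w = eval_width (length \<phi>) \<gamma> \<beta>"
    and \<rho>s: "length \<rho>s = learn_samples n w \<mu> \<gamma> \<delta>"
    and \<sigma>s: "length \<sigma>s = test_samples w \<mu> \<gamma> \<delta>"
  shows "result (cnf_eval n \<mu> \<phi> \<delta> \<gamma> \<beta> (\<rho>s @ \<sigma>s)) =
    (if real (length (filter (falsified (map (reduce (learned n w \<mu> \<gamma> \<delta> \<rho>s)) \<phi>)) \<sigma>s))
         > 5 * \<mu> ^ w * \<gamma> / 8 * real (test_samples w \<mu> \<gamma> \<delta>)
     then Reject else Accept)"
proof -
  have take_drop: "take (learn_samples n w \<mu> \<gamma> \<delta>) (\<rho>s @ \<sigma>s) = \<rho>s"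
    "drop (learn_samples n w \<mu> \<gamma> \<delta>) (\<rho>s @ \<sigma>s) = \<sigma>s"
    "take (test_samples w \<mu> \<gamma> \<delta>) \<sigma>s = \<sigma>s"
    using \<rho>s \<sigma>s by simp_all
  \<comment> \<open>The count starts at 0, so a nonnegative threshold establishes the loop
    invariant.\<close>
  have "real 0 \<le> 5 * \<mu> ^ w * \<gamma> / 8 * real (test_samples w \<mu> \<gamma> \<delta>)"
    using assms(1,2) by simp
  from result_test_t[OF this] show ?thesis
    by (simp del: take_append drop_append add: cnf_eval_def w[symmetric] take_drop
        result_learn_t learned_def)
qed

subsection \<open>Masking and concentration\<close>

fun var :: "literal \<Rightarrow> nat" where
  "var (Pos i) = i"
| "var (Neg i) = i"

text \<open>A clause with both literals of a variable is never false. So the literals of a false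
  clause sit on distinct variables, and \<open>card (set C)\<close> is the number of coordinates
  that must be revealed to witness this.\<close>

lemma inj_on_var_false:
  assumes "\<not> clause_true x C"
  shows "inj_on var (set C)"
proof (rule inj_onI)
  fix l l' assume "l \<in> set C" "l' \<in> set C" "var l = var l'"
  moreover from this have "\<not> lit_true x l" "\<not> lit_true x l'"
    using assms by (auto simp: clause_true_def)
  ultimately show "l = l'"
    by - (cases l; cases l'; simp)
qed

text \<open>Being witnessed false is a separate condition on each coordinate, so independence turns
  its probability into a product. A coordinate contributes \<mu> if it carries only a false literal,
  0 if it carries a true one, and 1 if it carries none.\<close>

lemma prob_mask_witnessed_false:
  assumes \<mu>: "0 \<le> \<mu>" "\<mu> \<le> 1" and C: "set C \<subseteq> literals n"
  shows "measure_pmf.prob (mask n \<mu> x) {\<rho>. witnessed_false \<rho> C} =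
    (if clause_true x C then 0 else \<mu> ^ card (set C))"
proof -
  define B where "B i = {v. (Pos i \<in> set C \<longrightarrow> v = Some False) \<and> (Neg i \<in> set C \<longrightarrow> v = Some True)}" for i
  define p where "p i = map_pmf (\<lambda>revealed. if revealed then Some (x i) else None) (bernoulli_pmf \<mu>)" for i
  have event: "{\<rho>. witnessed_false \<rho> C} = Pi {..<n} B"
  proof (intro set_eqI iffI)
    fix \<rho> assume "\<rho> \<in> {\<rho>. witnessed_false \<rho> C}"
    then show "\<rho> \<in> Pi {..<n} B" by (force simp: witnessed_false_def B_def)
  next
    fix \<rho> assume \<rho>: "\<rho> \<in> Pi {..<n} B"
    have "lit_witnessed_false \<rho> l" if "l \<in> set C" for l
    proof (cases l)
      case (Pos i)
      with that C have "i < n" by (auto simp: literals_def)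
      then show ?thesis using \<rho> that Pos by (auto simp: B_def Pi_def)
    next
      case (Neg i)
      with that C have "i < n" by (auto simp: literals_def)
      then show ?thesis using \<rho> that Neg by (auto simp: B_def Pi_def)
    qed
    then show "\<rho> \<in> {\<rho>. witnessed_false \<rho> C}" by (simp add: witnessed_false_def)
  qed
  have prod: "measure_pmf.prob (mask n \<mu> x) {\<rho>. witnessed_false \<rho> C}
      = (\<Prod>i<n. measure_pmf.prob (p i) (B i))"
    unfolding event mask_def p_def by (rule measure_Pi_pmf_Pi) simp
  have one: "measure_pmf.prob (p i) {Some (x i)} = \<mu>" for i
  proof -
    have "measure_pmf.prob (p i) {Some (x i)} = measure_pmf.prob (bernoulli_pmf \<mu>) {True}"
      unfolding p_def measure_map_pmf by (rule arg_cong2[where f = measure]) (auto split: if_splits)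
    then show ?thesis using \<mu> by (simp add: measure_pmf_single)
  qed
  have supp: "set_pmf (p i) \<subseteq> {None, Some (x i)}" for i
    by (auto simp: p_def)
  have zero: "measure_pmf.prob (p i) (B i) = 0" if "l \<in> set C" "lit_true x l" "i = var l" for i l
  proof -
    have "set_pmf (p i) \<inter> B i = {}"
      using that supp[of i] by - (cases l; auto simp: B_def)
    then show ?thesis by (simp add: measure_pmf_zero_iff)
  qed
  show ?thesis
  proof (cases "clause_true x C")
    case True
    then obtain l where l: "l \<in> set C" "lit_true x l" by (auto simp: clause_true_def)
    then have "var l < n" using C by - (cases l; auto simp: literals_def)
    then show ?thesis using zero[OF l refl] True prod by (auto intro!: prod_zero)
  next
    case False
    have val: "measure_pmf.prob (p i) (B i) = (if i \<in> var ` set C then \<mu> else 1)" for i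
    proof (cases "i \<in> var ` set C")
      case True
      then obtain l where l: "l \<in> set C" "i = var l" by auto
      \<comment> \<open>By injectivity the coordinate carries a single literal, so
        \<open>B i\<close> is a singleton; as this literal is false at \<open>x\<close>, its element
        is the revealed value of \<open>x i\<close>.\<close>
      have "l' = l" if "l' \<in> set C" "var l' = i" for l'
        using inj_on_var_false[OF False] that l by (auto dest: inj_onD)
      then have "Pos i \<in> set C \<longrightarrow> Pos i = l" "Neg i \<in> set C \<longrightarrow> Neg i = l" by simp_all
      moreover have "\<not> lit_true x l" using False l(1) by (auto simp: clause_true_def)
      ultimately have "B i = {Some (x i)}"
        using l by - (cases l; simp add: B_def)
      then show ?thesis using True one by simp
    next
      case f: False
      then have "B i = UNIV" by (force simp: B_def)
      then show ?thesis using f by simp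
    qed
    have sub: "var ` set C \<subseteq> {..<n}" using C by (auto simp: literals_def)
    have "(\<Prod>i<n. measure_pmf.prob (p i) (B i)) = (\<Prod>i\<in>var ` set C. \<mu>)"
      unfolding val using sub by (intro prod.mono_neutral_cong_right) auto
    also have "\<dots> = \<mu> ^ card (set C)"
      by (simp add: card_image[OF inj_on_var_false[OF False]])
    finally show ?thesis using prod False by simp
  qed
qed

lemma measure_bind_pmf:
  "measure_pmf.prob (bind_pmf M f) X = measure_pmf.expectation M (\<lambda>x. measure_pmf.prob (f x) X)"
proof -
  have "ennreal (measure_pmf.prob (bind_pmf M f) X)
      = (\<integral>\<^sup>+x. ennreal (measure_pmf.prob (f x) X) \<partial>M)"
    using emeasure_bind_pmf[of M f X] by (simp add: measure_pmf.emeasure_eq_measure)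
  also have "\<dots> = ennreal (measure_pmf.expectation M (\<lambda>x. measure_pmf.prob (f x) X))"
    by (intro nn_integral_eq_integral measure_pmf.integrable_const_bound[where B = 1]) auto
  finally show ?thesis by (simp add: integral_nonneg_AE)
qed

lemma integrable_prob_pmf: "integrable (measure_pmf M) (\<lambda>x. measure_pmf.prob (f x) X)"
  by (intro measure_pmf.integrable_const_bound[where B = 1]) auto

lemma integrable_indicator_pmf: "integrable (measure_pmf M) (indicator A :: _ \<Rightarrow> real)"
  by (intro measure_pmf.integrable_const_bound[where B = 1]) auto

lemma prob_bind_pmf_ge:
  assumes "\<And>x. x \<in> A \<Longrightarrow> c \<le> measure_pmf.prob (f x) X"
  shows "c * measure_pmf.prob M A \<le> measure_pmf.prob (bind_pmf M f) X"
proof -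
  have "c * measure_pmf.prob M A = measure_pmf.expectation M (\<lambda>x. c * indicator A x)"
    by simp
  also have "\<dots> \<le> measure_pmf.prob (bind_pmf M f) X"
    unfolding measure_bind_pmf
    by (intro integral_mono integrable_prob_pmf integrable_mult_right integrable_indicator_pmf)
      (use assms in \<open>auto simp: indicator_def\<close>)
  finally show ?thesis .
qed

text \<open>With \<open>c = 1\<close>, the set \<open>A\<close> holds the outcomes written off in
  the first stage, and \<open>d\<close> bounds the failure in the second. Asking for the bound only
  on the support keeps facts such as the length of a sample list available.\<close>

lemma prob_bind_pmf_le:
  assumes "\<And>x. x \<in> set_pmf M \<Longrightarrow> measure_pmf.prob (f x) X \<le> c * indicator A x + d"
  shows "measure_pmf.prob (bind_pmf M f) X \<le> c * measure_pmf.prob M A + d"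
proof -
  have "measure_pmf.prob (bind_pmf M f) X \<le> measure_pmf.expectation M (\<lambda>x. c * indicator A x + d)"
    unfolding measure_bind_pmf
    by (intro integral_mono_AE integrable_prob_pmf Bochner_Integration.integrable_add integrable_mult_right
        integrable_indicator_pmf measure_pmf.integrable_const)
      (use assms in \<open>auto simp: AE_measure_pmf_iff\<close>)
  also have "\<dots> = c * measure_pmf.prob M A + d"
    by (subst Bochner_Integration.integral_add)
      (auto intro!: integrable_indicator_pmf)
  finally show ?thesis .
qed

definition false_prob :: "assignment pmf \<Rightarrow> clause \<Rightarrow> real" where
  "false_prob D C = measure_pmf.prob D {x. \<not> clause_true x C}"

definition witness_prob :: "nat \<Rightarrow> real \<Rightarrow> assignment pmf \<Rightarrow> clause \<Rightarrow> real" where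
  "witness_prob n \<mu> D C = measure_pmf.prob (masked n \<mu> D) {\<rho>. witnessed_false \<rho> C}"

text \<open>Which coordinates are revealed does not depend on the point, so a false clause is
  witnessed with the same probability wherever it is false. This converts frequencies on masked data
  into probabilities under \<open>D\<close>.\<close>

lemma witness_prob_eq:
  assumes "0 \<le> \<mu>" "\<mu> \<le> 1" "set C \<subseteq> literals n"
  shows "witness_prob n \<mu> D C = \<mu> ^ card (set C) * false_prob D C"
proof -
  have "witness_prob n \<mu> D C
      = measure_pmf.expectation D (\<lambda>x. \<mu> ^ card (set C) * indicator {x. \<not> clause_true x C} x)"
    unfolding witness_prob_def masked_def measure_bind_pmf prob_mask_witnessed_false[OF assms]
    by (intro Bochner_Integration.integral_cong) auto
  then show ?thesis by (simp add: false_prob_def)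
qed

text \<open>A revealed value is the true one, so a clause is witnessed false only where it is
  false.\<close>

lemma prob_falsified_le:
  assumes "0 \<le> \<mu>" "\<mu> \<le> 1" "cnf_over n \<phi>"
  shows "measure_pmf.prob (masked n \<mu> D) {\<rho>. falsified \<phi> \<rho>}
    \<le> measure_pmf.prob D {x. \<not> cnf_true x \<phi>}"
proof -
  have zero: "measure_pmf.prob (mask n \<mu> x) {\<rho>. falsified \<phi> \<rho>} = 0" if "cnf_true x \<phi>" for x
  proof -
    have "measure_pmf.prob (mask n \<mu> x) {\<rho>. witnessed_false \<rho> C} = 0" if "C \<in> set \<phi>" for C
      using assms \<open>cnf_true x \<phi>\<close> that by (simp add: prob_mask_witnessed_false cnf_over_def cnf_true_def)
    then show ?thesis by (auto simp: measure_pmf_zero_iff falsified_def)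
  qed
  have "measure_pmf.prob (mask n \<mu> x) {\<rho>. falsified \<phi> \<rho>}
      \<le> 1 * indicator {x. \<not> cnf_true x \<phi>} x + 0" for x
    using zero[of x] by (simp add: indicator_def)
  from prob_bind_pmf_le[OF this] show ?thesis by (simp add: masked_def)
qed

text \<open>At each point a single narrow false clause is picked, depending on the point, so the
  loss is \<open>\<mu> ^ w\<close> without any factor for the number of clauses.\<close>

lemma prob_falsified_ge:
  assumes \<mu>: "0 \<le> \<mu>" "\<mu> \<le> 1" and \<phi>: "cnf_over n \<phi>"
  shows "\<mu> ^ w * measure_pmf.prob D {x. \<exists>C\<in>set \<phi>. card (set C) \<le> w \<and> \<not> clause_true x C}
    \<le> measure_pmf.prob (masked n \<mu> D) {\<rho>. falsified \<phi> \<rho>}"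
  unfolding masked_def
proof (rule prob_bind_pmf_ge)
  fix x assume "x \<in> {x. \<exists>C\<in>set \<phi>. card (set C) \<le> w \<and> \<not> clause_true x C}"
  then obtain C where C: "C \<in> set \<phi>" "card (set C) \<le> w" "\<not> clause_true x C" by auto
  have "\<mu> ^ w \<le> \<mu> ^ card (set C)" using C \<mu> by (intro power_decreasing)
  also have "\<dots> = measure_pmf.prob (mask n \<mu> x) {\<rho>. witnessed_false \<rho> C}"
    using C \<mu> \<phi> by (simp add: prob_mask_witnessed_false cnf_over_def)
  also have "\<dots> \<le> measure_pmf.prob (mask n \<mu> x) {\<rho>. falsified \<phi> \<rho>}"
    using C by (intro measure_pmf.finite_measure_mono) (auto simp: falsified_def)
  finally show "\<mu> ^ w \<le> measure_pmf.prob (mask n \<mu> x) {\<rho>. falsified \<phi> \<rho>}" .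
qed

section \<open>Concentration of counts in independent samples\<close>

lemma map_replicate_pmf: "map_pmf (map f) (replicate_pmf m M) = replicate_pmf m (map_pmf f M)"
proof (induction m)
  case (Suc m)
  show ?case
    by (simp add: map_bind_pmf bind_map_pmf Suc.IH[symmetric])
qed simp

lemma map_pmf_bernoulli: "map_pmf P M = bernoulli_pmf (measure_pmf.prob M {x. P x})"
proof (rule pmf_eqI)
  fix b
  have "measure_pmf.prob M {x. \<not> P x} = 1 - measure_pmf.prob M {x. P x}"
    using measure_pmf.prob_compl[of "{x. P x}" M] by (simp add: Collect_neg_eq Compl_eq_Diff_UNIV)
  then show "pmf (map_pmf P M) b = pmf (bernoulli_pmf (measure_pmf.prob M {x. P x})) b"
    by (cases b) (auto simp: pmf_map vimage_def)
qed

lemma count_replicate_pmf: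
  "map_pmf (\<lambda>xs. length (filter P xs)) (replicate_pmf m M)
    = binomial_pmf m (measure_pmf.prob M {x. P x})"
proof -
  have "binomial_pmf m (measure_pmf.prob M {x. P x})
      = map_pmf (length \<circ> filter id) (map_pmf (map P) (replicate_pmf m M))"
    by (simp add: binomial_pmf_altdef map_replicate_pmf map_pmf_bernoulli)
  also have "\<dots> = map_pmf (\<lambda>xs. length (filter P xs)) (replicate_pmf m M)"
    unfolding map_pmf_comp by (intro map_pmf_cong) (auto simp: filter_map)
  finally show ?thesis by simp
qed

lemma hoeffding_count:
  fixes M :: "'a pmf" and P :: "'a \<Rightarrow> bool"
  defines "p \<equiv> measure_pmf.prob M {x. P x}"
  assumes "0 \<le> \<epsilon>"
  shows hoeffding_count_ge: "measure_pmf.prob (replicate_pmf m M)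
      {xs. real (length (filter P xs)) \<ge> real m * (p + \<epsilon>)} \<le> exp (- 2 * real m * \<epsilon>\<^sup>2)"
    and hoeffding_count_le: "measure_pmf.prob (replicate_pmf m M)
      {xs. real (length (filter P xs)) \<le> real m * (p - \<epsilon>)} \<le> exp (- 2 * real m * \<epsilon>\<^sup>2)"
proof -
  interpret binomial_distribution m p by standard (simp add: p_def)
  have map: "measure_pmf.prob (replicate_pmf m M) {xs. Q (length (filter P xs))}
      = measure_pmf.prob (binomial_pmf m p) {k. Q k}" for Q
    unfolding p_def count_replicate_pmf[symmetric] by simp
  show "measure_pmf.prob (replicate_pmf m M)
      {xs. real (length (filter P xs)) \<ge> real m * (p + \<epsilon>)} \<le> exp (- 2 * real m * \<epsilon>\<^sup>2)"
  \<comment> \<open>For an empty sample the right-hand side is \<open>exp 0 = 1\<close>; otherwise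
    the binomial tail bound applies.\<close>
  proof (cases "m = 0")
    case False
    then show ?thesis using prob_ge'[of \<epsilon>] \<open>0 \<le> \<epsilon>\<close>
      unfolding map[of "\<lambda>k. real k \<ge> real m * (p + \<epsilon>)"] by (simp add: field_simps)
  qed simp
  show "measure_pmf.prob (replicate_pmf m M)
      {xs. real (length (filter P xs)) \<le> real m * (p - \<epsilon>)} \<le> exp (- 2 * real m * \<epsilon>\<^sup>2)"
  proof (cases "m = 0")
    case False
    then show ?thesis using prob_le'[of \<epsilon>] \<open>0 \<le> \<epsilon>\<close>
      unfolding map[of "\<lambda>k. real k \<le> real m * (p - \<epsilon>)"] by (simp add: field_simps)
  qed simp
qed

text \<open>Once the first block is fixed, everything computed from it is constant while the second
  block is still fresh. So Hoeffding's inequality applies to the tests although the tested formula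
  depends on the data, and the two failure probabilities add.\<close>

lemma replicate_pmf_two_stage:
  assumes first: "measure_pmf.prob (replicate_pmf a M) {xs. \<not> G xs} \<le> \<delta>\<^sub>1"
    and second: "\<And>xs. length xs = a \<Longrightarrow> G xs \<Longrightarrow>
      measure_pmf.prob (replicate_pmf b M) {ys. \<not> E (xs @ ys)} \<le> \<delta>\<^sub>2"
    and "0 \<le> \<delta>\<^sub>2"
  shows "measure_pmf.prob (replicate_pmf (a + b) M) {zs. E zs} \<ge> 1 - (\<delta>\<^sub>1 + \<delta>\<^sub>2)"
proof -
  have "replicate_pmf (a + b) M
      = bind_pmf (replicate_pmf a M) (\<lambda>xs. map_pmf ((@) xs) (replicate_pmf b M))"
    by (simp add: replicate_pmf_distrib map_pmf_def)
  moreover have "measure_pmf.prob (map_pmf ((@) xs) (replicate_pmf b M)) {zs. \<not> E zs}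
      \<le> 1 * indicator {xs. \<not> G xs} xs + \<delta>\<^sub>2" if "xs \<in> set_pmf (replicate_pmf a M)" for xs
  proof (cases "G xs")
    case True
    then show ?thesis using second[of xs] that by (simp add: set_replicate_pmf vimage_def)
  next
    case False
    then show ?thesis using \<open>0 \<le> \<delta>\<^sub>2\<close> by (simp add: add_increasing2)
  qed
  ultimately have "measure_pmf.prob (replicate_pmf (a + b) M) {zs. \<not> E zs} \<le> \<delta>\<^sub>1 + \<delta>\<^sub>2"
    using prob_bind_pmf_le[of "replicate_pmf a M"
        "\<lambda>xs. map_pmf ((@) xs) (replicate_pmf b M)" "{zs. \<not> E zs}" 1 "{xs. \<not> G xs}" \<delta>\<^sub>2] first
    by simp
  moreover have "measure_pmf.prob (replicate_pmf (a + b) M) {zs. \<not> E zs}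
      = 1 - measure_pmf.prob (replicate_pmf (a + b) M) {zs. E zs}"
    using measure_pmf.prob_compl[of "{zs. E zs}" "replicate_pmf (a + b) M"]
    by (simp add: Collect_neg_eq Compl_eq_Diff_UNIV)
  ultimately show ?thesis by simp
qed

subsection \<open>Learning\<close>

text \<open>Since \<open>exp 1 < 4\<close>, the logarithm exceeds 1 and the real width exceeds 2, so
  rounding up gives at least 3. Correctness uses only that the width is positive; the running time
  estimate uses the 3.\<close>

lemma eval_width_ge:
  assumes "m \<ge> 1" "0 < \<gamma>" "\<gamma> \<le> 1" "0 < \<beta>" "\<beta> \<le> 1"
  shows "real (eval_width m \<gamma> \<beta>) \<ge> 2 / \<beta> * ln (4 * real m / \<gamma>)" "eval_width m \<gamma> \<beta> \<ge> 3"
proof -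
  have "4 * \<gamma> \<le> 4 * real m" using assms by simp
  then have "4 \<le> 4 * real m / \<gamma>" using assms by (simp add: field_simps)
  moreover have "exp 1 < (4::real)" using exp_le by simp
  ultimately have "exp 1 < 4 * real m / \<gamma>" by linarith
  then have ln: "1 < ln (4 * real m / \<gamma>)"
    by (metis exp_gt_zero ln_exp ln_less_cancel_iff order_less_trans)
  have "2 * 1 < 2 / \<beta> * ln (4 * real m / \<gamma>)"
    using assms ln by (intro mult_le_less_imp_less) (auto simp: field_simps)
  then show "real (eval_width m \<gamma> \<beta>) \<ge> 2 / \<beta> * ln (4 * real m / \<gamma>)" "eval_width m \<gamma> \<beta> \<ge> 3"
    unfolding eval_width_def by linarith+
qed

text \<open>From \<open>1 - \<beta> \<le> exp (- \<beta>)\<close>. The factor 2 in the width yields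
  the square: a union bound over the clauses of the input takes one factor \<open>m\<close>, and at
  most \<gamma>/16 is left.\<close>

lemma balanced_width_bound:
  assumes "m \<ge> 1" "0 < \<gamma>" "\<gamma> \<le> 1" "0 < \<beta>" "\<beta> \<le> 1"
  shows "(1 - \<beta>) ^ eval_width m \<gamma> \<beta> \<le> (\<gamma> / (4 * real m))\<^sup>2"
proof -
  let ?w = "eval_width m \<gamma> \<beta>" and ?L = "ln (4 * real m / \<gamma>)"
  have "1 - \<beta> \<le> exp (- \<beta>)" using exp_ge_add_one_self[of "- \<beta>"] by simp
  then have "(1 - \<beta>) ^ ?w \<le> exp (- \<beta>) ^ ?w" using assms by (intro power_mono) auto
  also have "\<dots> = exp (- (\<beta> * real ?w))" by (simp add: exp_of_nat_mult[symmetric] mult.commute)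
  also have "\<dots> \<le> exp (- (2 * ?L))"
    using eval_width_ge(1)[OF assms] assms by (simp add: field_simps)
  also have "\<dots> = (exp (- ?L))\<^sup>2" by (simp add: power2_eq_square flip: exp_add)
  also have "exp (- ?L) = \<gamma> / (4 * real m)" using assms by (simp add: exp_minus)
  finally show ?thesis .
qed

text \<open>The learning cut-off divided by the sample size, which makes it comparable with
  \<open>witness_prob\<close>.\<close>

definition witness_threshold :: "nat \<Rightarrow> nat \<Rightarrow> real \<Rightarrow> real \<Rightarrow> real" where
  "witness_threshold n w \<mu> \<gamma> = \<gamma> * \<mu> ^ (2 * w) / (4 * (2 * real n + 1) ^ w)"

text \<open>The sample size is chosen so that the exponent is at least \<open>w\<close> times the
  logarithm. This factor \<open>w\<close> produces a \<open>w\<close>-th power, which is what a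
  union bound over \<open>(2 * n + 1) ^ w\<close> clauses calls for.\<close>

lemma learn_samples_deviation:
  assumes "0 < \<mu>" "0 < \<gamma>" "0 < \<delta>"
  shows "exp (- 2 * real (learn_samples n w \<mu> \<gamma> \<delta>) * (witness_threshold n w \<mu> \<gamma> / 2)\<^sup>2)
    \<le> (\<delta> / (4 * real n + 2)) ^ w"
proof -
  define P where "P = (2 * real n + 1) ^ w"
  define M where "M = \<mu> ^ w"
  let ?L = "ln ((4 * real n + 2) / \<delta>)"
  have pos: "P > 0" "M > 0" using assms by (simp_all add: P_def M_def add_nonneg_pos)
  have pow: "(2 * real n + 1) ^ (2 * w) = P\<^sup>2" "\<mu> ^ (4 * w) = M ^ 4" "\<mu> ^ (2 * w) = M\<^sup>2"
    by (simp_all add: P_def M_def power_mult[symmetric] mult.commute)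
  have "32 * real w * P\<^sup>2 / (M ^ 4 * \<gamma>\<^sup>2) * ?L \<le> real (learn_samples n w \<mu> \<gamma> \<delta>)"
    unfolding learn_samples_def pow by linarith
  then have "32 * real w * P\<^sup>2 / (M ^ 4 * \<gamma>\<^sup>2) * ?L * (2 * (\<gamma> * M\<^sup>2 / (4 * P) / 2)\<^sup>2)
      \<le> real (learn_samples n w \<mu> \<gamma> \<delta>) * (2 * (\<gamma> * M\<^sup>2 / (4 * P) / 2)\<^sup>2)"
    by (intro mult_right_mono) auto
  moreover have "32 * real w * P\<^sup>2 / (M ^ 4 * \<gamma>\<^sup>2) * ?L * (2 * (\<gamma> * M\<^sup>2 / (4 * P) / 2)\<^sup>2) = real w * ?L"
    using pos assms by (simp add: field_simps power2_eq_square power4_eq_xxxx)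
  moreover have "witness_threshold n w \<mu> \<gamma> = \<gamma> * M\<^sup>2 / (4 * P)"
    by (simp only: witness_threshold_def pow P_def)
  ultimately have "real w * ?L
      \<le> real (learn_samples n w \<mu> \<gamma> \<delta>) * (2 * (witness_threshold n w \<mu> \<gamma> / 2)\<^sup>2)"
    by (simp only:)
  then have "exp (- 2 * real (learn_samples n w \<mu> \<gamma> \<delta>) * (witness_threshold n w \<mu> \<gamma> / 2)\<^sup>2)
      \<le> exp (- (real w * ?L))"
    by (simp add: mult_ac)
  also have "\<dots> = exp (- ?L) ^ w" by (simp add: exp_of_nat_mult[symmetric])
  also have "exp (- ?L) = \<delta> / (4 * real n + 2)"
    using assms by (simp add: exp_minus add_nonneg_pos)
  finally show ?thesis .
qed

text \<open>The deviation is an eighth of \<open>\<mu> ^ w * \<gamma>\<close> because the test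
  threshold, 5/8 of it, lies midway between the bounds 1/2 and 3/4 that hold for valid and for
  invalid formulas.\<close>

lemma test_samples_deviation:
  assumes "0 < \<mu>" "0 < \<gamma>" "0 < \<delta>"
  shows "exp (- 2 * real (test_samples w \<mu> \<gamma> \<delta>) * (\<mu> ^ w * \<gamma> / 8)\<^sup>2) \<le> \<delta> / 2"
proof -
  define M where "M = \<mu> ^ w * \<gamma>"
  have pos: "M > 0" using assms by (simp add: M_def)
  have "32 / M\<^sup>2 * ln (2 / \<delta>) \<le> real (test_samples w \<mu> \<gamma> \<delta>)"
    unfolding test_samples_def M_def by linarith
  then have "32 / M\<^sup>2 * ln (2 / \<delta>) * (2 * (M / 8)\<^sup>2) \<le> real (test_samples w \<mu> \<gamma> \<delta>) * (2 * (M / 8)\<^sup>2)"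
    by (intro mult_right_mono) auto
  moreover have "32 / M\<^sup>2 * ln (2 / \<delta>) * (2 * (M / 8)\<^sup>2) = ln (2 / \<delta>)"
    using pos by (simp add: field_simps power2_eq_square)
  ultimately have "exp (- 2 * real (test_samples w \<mu> \<gamma> \<delta>) * (M / 8)\<^sup>2) \<le> exp (- ln (2 / \<delta>))"
    by (simp add: mult.commute mult.left_commute)
  also have "\<dots> = \<delta> / 2" using assms by (simp add: exp_minus)
  finally show ?thesis by (simp add: M_def)
qed

text \<open>The number of clauses and the bound for each are \<open>w\<close>-th powers whose
  product is at most \<open>(\<delta> / 2) ^ w\<close>; a positive exponent only helps, as
  \<delta>/2 is below 1.\<close>

lemma union_bound_narrow_clauses:
  fixes R :: "'a pmf"
  assumes each: "\<And>C. C \<in> set (narrow_clauses n w) \<Longrightarrow>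
      measure_pmf.prob R (bad C) \<le> (\<delta> / (4 * real n + 2)) ^ w"
    and "0 < \<delta>" "\<delta> < 1" "w \<ge> 1"
  shows "measure_pmf.prob R (\<Union>C\<in>set (narrow_clauses n w). bad C) \<le> \<delta> / 2"
proof -
  have "measure_pmf.prob R (\<Union>C\<in>set (narrow_clauses n w). bad C)
      \<le> (\<Sum>C\<in>set (narrow_clauses n w). measure_pmf.prob R (bad C))"
    by (intro measure_pmf.finite_measure_subadditive_finite) auto
  also have "\<dots> \<le> (\<Sum>C\<in>set (narrow_clauses n w). (\<delta> / (4 * real n + 2)) ^ w)"
    by (intro sum_mono each)
  also have "\<dots> = real (card (set (narrow_clauses n w))) * (\<delta> / (4 * real n + 2)) ^ w" by simp
  also have "\<dots> \<le> (2 * real n + 1) ^ w * (\<delta> / (4 * real n + 2)) ^ w"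
  proof (intro mult_right_mono)
    have "card (set (narrow_clauses n w)) \<le> (2 * n + 1) ^ w"
      using card_length length_narrow_clauses order_trans by blast
    then have "real (card (set (narrow_clauses n w))) \<le> real ((2 * n + 1) ^ w)"
      using of_nat_le_iff by blast
    then show "real (card (set (narrow_clauses n w))) \<le> (2 * real n + 1) ^ w" by (simp add: add.commute)
  qed (use assms in auto)
  also have "\<dots> = ((2 * real n + 1) * (\<delta> / (4 * real n + 2))) ^ w"
    by (rule power_mult_distrib[symmetric])
  also have "(2 * real n + 1) * (\<delta> / (4 * real n + 2)) = \<delta> / 2" by (simp add: field_simps)
  also have "(\<delta> / 2) ^ w \<le> \<delta> / 2"
    using assms power_decreasing[of 1 w "\<delta> / 2"] by simp
  finally show ?thesis .
qed

section \<open>Guarantees for the learned clauses\<close>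

lemma learned_alt:
  "set (learned n w \<mu> \<gamma> \<delta> \<rho>s) = {C \<in> set (narrow_clauses n w).
     real (false_count \<rho>s C) \<le> real (learn_samples n w \<mu> \<gamma> \<delta>) * witness_threshold n w \<mu> \<gamma>}"
  by (simp add: learned_def witness_threshold_def mult.commute)

text \<open>A clause above 3/2 of the cut-off is learned only if its count falls short of its mean
  by half the cut-off per sample. Acceptance relies on this side alone.\<close>

lemma learned_sound:
  fixes D :: "assignment pmf"
  assumes "0 < \<mu>" "0 < \<gamma>" "0 < \<delta>" "\<delta> < 1" "w \<ge> 1"
  shows "measure_pmf.prob (replicate_pmf (learn_samples n w \<mu> \<gamma> \<delta>) (masked n \<mu> D))
    {\<rho>s. \<not> (\<forall>C\<in>set (learned n w \<mu> \<gamma> \<delta> \<rho>s).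
       witness_prob n \<mu> D C \<le> 3 / 2 * witness_threshold n w \<mu> \<gamma>)} \<le> \<delta> / 2"
proof -
  let ?m = "learn_samples n w \<mu> \<gamma> \<delta>" and ?\<tau> = "witness_threshold n w \<mu> \<gamma>"
  let ?R = "replicate_pmf ?m (masked n \<mu> D)"
  \<comment> \<open>The condition on \<open>witness_prob\<close> is part of the event, so the event
    is empty for harmless clauses and one bound covers all clauses.\<close>
  define bad where "bad C = {\<rho>s. witness_prob n \<mu> D C > 3 / 2 * ?\<tau> \<and> real (false_count \<rho>s C) \<le> real ?m * ?\<tau>}" for C
  have \<tau>: "0 \<le> ?\<tau>" using assms by (simp add: witness_threshold_def)
  have "measure_pmf.prob ?R (bad C) \<le> (\<delta> / (4 * real n + 2)) ^ w" for C
  proof -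
    have "bad C \<subseteq> {\<rho>s. real (length (filter (\<lambda>\<rho>. witnessed_false \<rho> C) \<rho>s))
        \<le> real ?m * (measure_pmf.prob (masked n \<mu> D) {\<rho>. witnessed_false \<rho> C} - ?\<tau> / 2)}" (is "_ \<subseteq> ?B")
    proof
      fix \<rho>s assume b: "\<rho>s \<in> bad C"
      then have "real ?m * ?\<tau> \<le> real ?m * (witness_prob n \<mu> D C - ?\<tau> / 2)"
        by (intro mult_left_mono) (auto simp: bad_def)
      then show "\<rho>s \<in> ?B" using b by (auto simp: bad_def false_count_def witness_prob_def)
    qed
    then have "measure_pmf.prob ?R (bad C) \<le> measure_pmf.prob ?R ?B"
      by (intro measure_pmf.finite_measure_mono) auto
    also have "\<dots> \<le> exp (- 2 * real ?m * (?\<tau> / 2)\<^sup>2)" using \<tau> by (intro hoeffding_count_le) simp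
    also have "\<dots> \<le> (\<delta> / (4 * real n + 2)) ^ w" using assms by (intro learn_samples_deviation)
    finally show ?thesis .
  qed
  from union_bound_narrow_clauses[where bad = bad, OF this assms(3-5)]
  have "measure_pmf.prob ?R (\<Union>C\<in>set (narrow_clauses n w). bad C) \<le> \<delta> / 2" .
  moreover have "{\<rho>s. \<not> (\<forall>C\<in>set (learned n w \<mu> \<gamma> \<delta> \<rho>s). witness_prob n \<mu> D C \<le> 3 / 2 * ?\<tau>)}
      = (\<Union>C\<in>set (narrow_clauses n w). bad C)"
    unfolding learned_alt bad_def by (auto simp: not_le)
  ultimately show ?thesis by simp
qed

text \<open>The opposite deviation: a clause below half the cut-off is missed only if its count is
  too large. Rejection relies on this side alone, so each verdict pays \<delta>/2 for
  learning.\<close>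

lemma learned_complete:
  fixes D :: "assignment pmf"
  assumes "0 < \<mu>" "0 < \<gamma>" "0 < \<delta>" "\<delta> < 1" "w \<ge> 1"
  shows "measure_pmf.prob (replicate_pmf (learn_samples n w \<mu> \<gamma> \<delta>) (masked n \<mu> D))
    {\<rho>s. \<not> (\<forall>C\<in>set (narrow_clauses n w).
       witness_prob n \<mu> D C \<le> witness_threshold n w \<mu> \<gamma> / 2 \<longrightarrow> C \<in> set (learned n w \<mu> \<gamma> \<delta> \<rho>s))} \<le> \<delta> / 2"
proof -
  let ?m = "learn_samples n w \<mu> \<gamma> \<delta>" and ?\<tau> = "witness_threshold n w \<mu> \<gamma>"
  let ?R = "replicate_pmf ?m (masked n \<mu> D)"
  define bad where "bad C = {\<rho>s. witness_prob n \<mu> D C \<le> ?\<tau> / 2 \<and> real (false_count \<rho>s C) > real ?m * ?\<tau>}" for C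
  have \<tau>: "0 \<le> ?\<tau>" using assms by (simp add: witness_threshold_def)
  have "measure_pmf.prob ?R (bad C) \<le> (\<delta> / (4 * real n + 2)) ^ w" for C
  proof -
    have "bad C \<subseteq> {\<rho>s. real (length (filter (\<lambda>\<rho>. witnessed_false \<rho> C) \<rho>s))
        \<ge> real ?m * (measure_pmf.prob (masked n \<mu> D) {\<rho>. witnessed_false \<rho> C} + ?\<tau> / 2)}" (is "_ \<subseteq> ?B")
    proof
      fix \<rho>s assume b: "\<rho>s \<in> bad C"
      then have "real ?m * (witness_prob n \<mu> D C + ?\<tau> / 2) \<le> real ?m * ?\<tau>"
        by (intro mult_left_mono) (auto simp: bad_def)
      then show "\<rho>s \<in> ?B" using b by (auto simp: bad_def false_count_def witness_prob_def)
    qed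
    then have "measure_pmf.prob ?R (bad C) \<le> measure_pmf.prob ?R ?B"
      by (intro measure_pmf.finite_measure_mono) auto
    also have "\<dots> \<le> exp (- 2 * real ?m * (?\<tau> / 2)\<^sup>2)" using \<tau> by (intro hoeffding_count_ge) simp
    also have "\<dots> \<le> (\<delta> / (4 * real n + 2)) ^ w" using assms by (intro learn_samples_deviation)
    finally show ?thesis .
  qed
  from union_bound_narrow_clauses[where bad = bad, OF this assms(3-5)]
  have "measure_pmf.prob ?R (\<Union>C\<in>set (narrow_clauses n w). bad C) \<le> \<delta> / 2" .
  moreover have "{\<rho>s. \<not> (\<forall>C\<in>set (narrow_clauses n w).
       witness_prob n \<mu> D C \<le> ?\<tau> / 2 \<longrightarrow> C \<in> set (learned n w \<mu> \<gamma> \<delta> \<rho>s))}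
      = (\<Union>C\<in>set (narrow_clauses n w). bad C)"
    unfolding learned_alt bad_def by (auto simp: not_le)
  ultimately show ?thesis by simp
qed

subsection \<open>Wide clauses under a correlation gap\<close>

definition all_false :: "literal set \<Rightarrow> assignment set" where
  "all_false A = {x. \<forall>l\<in>A. \<not> lit_true x l}"

lemma false_prob_eq: "false_prob D C = measure_pmf.prob D (all_false (set C))"
  by (simp add: false_prob_def all_false_def clause_true_def)

text \<open>Demanding that \<open>neg l\<close> be false means that \<open>l\<close> is true, so the
  summands are the cases of \<open>l\<close> true and \<open>l\<close> false.\<close>

lemma all_false_split:
  "measure_pmf.prob D (all_false B)
    = measure_pmf.prob D (all_false (insert (neg l) B)) + measure_pmf.prob D (all_false (insert l B))"
proof -
  have "all_false B = all_false (insert (neg l) B) \<union> all_false (insert l B)"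
    by (auto simp: all_false_def)
  moreover have "all_false (insert (neg l) B) \<inter> all_false (insert l B) = {}"
    by (auto simp: all_false_def)
  ultimately show ?thesis by (metis measure_pmf.finite_measure_Union UNIV_I sets_measure_pmf)
qed

lemma all_false_antimono:
  "A \<subseteq> B \<Longrightarrow> measure_pmf.prob D (all_false B) \<le> measure_pmf.prob D (all_false A)"
  by (intro measure_pmf.finite_measure_mono) (auto simp: all_false_def)

text \<open>The gap conditions on true literals given as a list, so it is applied to the negations
  of a duplicate-free listing of \<open>B\<close>, and the conditional probabilities are multiplied
  out. Of the balanced case only the bound for \<open>l\<close> true is kept, since it caps the
  probability that \<open>l\<close> is false.\<close>

lemma correlation_gapD:
  assumes gap: "correlation_gap n D w \<beta> q"
    and B: "B \<subseteq> literals n" "card B \<le> w" and l: "l \<in> literals n"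
    and nz: "measure_pmf.prob D (all_false B) \<noteq> 0"
  shows "\<beta> * measure_pmf.prob D (all_false B) \<le> measure_pmf.prob D (all_false (insert (neg l) B)) \<or>
    q * measure_pmf.prob D (all_false B) \<le> measure_pmf.prob D (all_false (insert (neg l) B)) \<or>
    q * measure_pmf.prob D (all_false B) \<le> measure_pmf.prob D (all_false (insert l B))"
proof -
  have "finite (literals n)" by (simp add: literals_def)
  then have "finite B" using B finite_subset by blast
  then obtain bs where bs: "set bs = B" "distinct bs" using finite_distinct_list by blast
  let ?L = "map neg bs"
  have L: "{x. \<forall>l\<in>set ?L. lit_true x l} = all_false B" using bs by (auto simp: all_false_def)
  have len: "length ?L \<le> w" "set ?L \<subseteq> literals n"
    using bs B distinct_card[of bs] by auto
  have i: "var l < n" using l by (cases l) (auto simp: literals_def)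
  \<comment> \<open>The value of the variable at which \<open>l\<close> is true.\<close>
  define t where "t = (case l of Pos _ \<Rightarrow> True | Neg _ \<Rightarrow> False)"
  have val: "lit_true x l \<longleftrightarrow> x (var l) = t" for x by (cases l) (auto simp: t_def)
  have cp: "cond_prob (measure_pmf D) (\<lambda>x. x (var l) = b) (\<lambda>x. \<forall>l\<in>set ?L. lit_true x l)
      = measure_pmf.prob D (all_false (insert (if b = t then neg l else l) B))
        / measure_pmf.prob D (all_false B)" for b
  proof -
    have "{x. x (var l) = b \<and> (\<forall>l\<in>set ?L. lit_true x l)} = all_false (insert (if b = t then neg l else l) B)"
      using L val by (auto simp: all_false_def)
    then show ?thesis using L by (simp add: cond_prob_def)
  qed
  have pos: "measure_pmf.prob D (all_false B) > 0"
    using nz by (simp add: zero_less_measure_iff)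
  have "(\<forall>b. cond_prob (measure_pmf D) (\<lambda>x. x (var l) = b) (\<lambda>x. \<forall>l\<in>set ?L. lit_true x l) \<ge> \<beta>) \<or>
        (\<exists>b. cond_prob (measure_pmf D) (\<lambda>x. x (var l) = b) (\<lambda>x. \<forall>l\<in>set ?L. lit_true x l) \<ge> q)"
    using gap[unfolded correlation_gap_def, rule_format, of ?L "var l"] len i nz
    unfolding L by blast
  then consider "cond_prob (measure_pmf D) (\<lambda>x. x (var l) = t) (\<lambda>x. \<forall>l\<in>set ?L. lit_true x l) \<ge> \<beta>"
    | b where "cond_prob (measure_pmf D) (\<lambda>x. x (var l) = b) (\<lambda>x. \<forall>l\<in>set ?L. lit_true x l) \<ge> q"
    by blast
  then show ?thesis
  proof cases
    case 1
    then show ?thesis using pos unfolding cp by (simp add: pos_le_divide_eq)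
  next
    case 2
    then show ?thesis using pos unfolding cp by (cases "b = t") (simp_all add: pos_le_divide_eq)
  qed
qed

text \<open>If every conditional in the chain is balanced, each of the first \<open>w\<close> literals costs a factor
  \<open>1 - \<beta>\<close>. A literal nearly forced to be false would, after enlarging the conditioning set to \<open>w - 1\<close>
  literals, contradict \<open>unforced\<close>: only clauses of full width \<open>w\<close> are witnessed rarely enough to be
  learned for sure.\<close>

lemma wide_clause_false_prob:
  fixes D :: "assignment pmf" and A :: "literal set"
  assumes gap: "correlation_gap n D w \<beta> (1 - g)" and \<beta>: "\<beta> \<le> 1" and g: "0 \<le> g"
    and A: "A \<subseteq> literals n" "w \<le> card A"
    and unforced: "\<And>B l. B \<subseteq> A \<Longrightarrow> l \<in> A \<Longrightarrow> l \<notin> B \<Longrightarrow> neg l \<notin> B \<Longrightarrow> card B = w - 1 \<Longrightarrow>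
      g < measure_pmf.prob D (all_false (insert (neg l) B))"
  shows "measure_pmf.prob D (all_false A) \<le> (1 - \<beta>) ^ w \<or>
    (\<exists>B\<subseteq>A. card B \<le> w \<and> measure_pmf.prob D (all_false B) \<le> g)"
proof (rule disjCI)
  assume "\<not> (\<exists>B\<subseteq>A. card B \<le> w \<and> measure_pmf.prob D (all_false B) \<le> g)"
  then have big: "g < measure_pmf.prob D (all_false B)" if "B \<subseteq> A" "card B \<le> w" for B
    using that by (meson not_le)
  have fin: "finite A" using A(1) by (rule finite_subset) (simp add: literals_def)
  show "measure_pmf.prob D (all_false A) \<le> (1 - \<beta>) ^ w"
  \<comment> \<open>A complementary pair makes the event impossible. Without one, the condition
    \<open>neg l \<notin> B\<close> in \<open>unforced\<close> comes for free.\<close>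
  proof (cases "\<exists>l\<in>A. neg l \<in> A")
    case True
    then obtain l where "l \<in> A" "neg l \<in> A" by blast
    then have "x \<notin> all_false A" for x
      using lit_true_neg[of x l] unfolding all_false_def by blast
    then have "all_false A = {}" by blast
    then show ?thesis using \<beta> by simp
  next
    case False
    have chain: "measure_pmf.prob D (all_false B) \<le> (1 - \<beta>) ^ card B" if "B \<subseteq> A" "card B \<le> w" for B
    proof -
      have "finite B" using that fin finite_subset by blast
      then show ?thesis using that
      proof (induction B rule: finite_induct)
        case (insert l B)
        let ?F = "measure_pmf.prob D (all_false B)"
        have F: "?F \<le> (1 - \<beta>) ^ card B" using insert by simp
        have card: "card B < w" using insert by simp
        have "?F > g" using insert by (intro big) auto
        then have nz: "?F \<noteq> 0" using g by simp
        have le: "?F * g \<le> g" using mult_left_le[of ?F g] g by (simp add: mult.commute)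
        note split = all_false_split[of D B l]
        have not_forced: "?F * g < measure_pmf.prob D (all_false (insert (neg l) B))"
        proof -
          have "card (A - {l}) \<ge> w - 1" using A(2) insert.prems fin by simp
          moreover have "card B \<le> w - 1" "B \<subseteq> A - {l}"
            using card insert.hyps insert.prems by auto
          \<comment> \<open>Removing \<open>l\<close> leaves at least \<open>w - 1\<close> literals
            of \<open>A\<close>, so \<open>B\<close> can be enlarged to the size that
            \<open>unforced\<close> speaks of; enlarging only lowers the probability.\<close>
          ultimately obtain B' where B': "B \<subseteq> B'" "B' \<subseteq> A - {l}" "card B' = w - 1"
            by (meson exists_subset_between fin finite_Diff)
          have "g < measure_pmf.prob D (all_false (insert (neg l) B'))"
            using B' False insert.prems by (intro unforced) auto
          also have "\<dots> \<le> measure_pmf.prob D (all_false (insert (neg l) B))"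
            using B' by (intro all_false_antimono) auto
          finally show ?thesis using le by simp
        qed
        \<comment> \<open>If \<open>l\<close> were nearly always true, \<open>insert l B\<close>
          would be false with probability at most \<open>g\<close>, against this bound. If
          \<open>l\<close> were nearly always false, \<open>not_forced\<close> would fail. Only the
          balanced alternative remains.\<close>
        have "g < measure_pmf.prob D (all_false (insert l B))" using insert by (intro big) auto
        then have "\<beta> * ?F \<le> measure_pmf.prob D (all_false (insert (neg l) B))"
          using correlation_gapD[OF gap _ _ _ nz, of l] split not_forced le insert A card
          by (auto simp: algebra_simps)
        then have "measure_pmf.prob D (all_false (insert l B)) \<le> (1 - \<beta>) * ?F"
          using split by (simp add: algebra_simps)
        also have "\<dots> \<le> (1 - \<beta>) * (1 - \<beta>) ^ card B" using F \<beta> by (intro mult_left_mono) auto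
        finally show ?case using insert by simp
      qed simp
    qed
    obtain B where "B \<subseteq> A" "card B = w" using A(2) by (meson obtain_subset_with_card_n)
    then show ?thesis using chain[of B] all_false_antimono[of B A D] by simp
  qed
qed

subsection \<open>Correctness of the verdict\<close>

lemma prob_some_clause_false_le:
  assumes "\<And>C. C \<in> set cs \<Longrightarrow> false_prob D C \<le> b" "0 \<le> b"
  shows "measure_pmf.prob D {x. \<exists>C\<in>set cs. \<not> clause_true x C} \<le> real (length cs) * b"
proof -
  have "{x. \<exists>C\<in>set cs. \<not> clause_true x C} = (\<Union>C\<in>set cs. {x. \<not> clause_true x C})" by auto
  then have "measure_pmf.prob D {x. \<exists>C\<in>set cs. \<not> clause_true x C}
      \<le> (\<Sum>C\<in>set cs. false_prob D C)"
    unfolding false_prob_def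
    by (simp add: measure_pmf.finite_measure_subadditive_finite)
  also have "\<dots> \<le> (\<Sum>C\<in>set cs. b)" using assms by (intro sum_mono)
  also have "\<dots> \<le> real (length cs) * b" using assms by (simp add: mult_right_mono card_length)
  finally show ?thesis .
qed

lemma cnf_over_reduce: "cnf_over n \<phi> \<Longrightarrow> cnf_over n (map (reduce \<psi>) \<phi>)"
  using reduce_shrinks by (fastforce simp: cnf_over_def)

lemma validity_compl: "measure_pmf.prob D {x. \<not> cnf_true x \<phi>} = 1 - validity D \<phi>"
  using measure_pmf.prob_compl[of "{x. cnf_true x \<phi>}" D]
  by (simp add: validity_def Collect_neg_eq Compl_eq_Diff_UNIV)

lemma length_narrow_clauses_filter:
  "real (length (filter Q (narrow_clauses n w))) \<le> (2 * real n + 1) ^ w"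
proof -
  have "length (filter Q (narrow_clauses n w)) \<le> (2 * n + 1) ^ w"
    using length_filter_le length_narrow_clauses order_trans by blast
  then have "real (length (filter Q (narrow_clauses n w))) \<le> real ((2 * n + 1) ^ w)"
    using of_nat_le_iff by blast
  then show ?thesis by (simp add: add.commute)
qed

text \<open>The reduced formula fails only where \<phi> or a learned clause fails. In units of
  \<open>\<gamma> * \<mu> ^ w\<close>, the former contributes 1/8. The latter contributes 3/8: 3/2
  of the cut-off, divided by the witnessing rate \<open>\<mu> ^ w\<close>, times at most
  \<open>(2 * n + 1) ^ w\<close> clauses.\<close>

lemma reduced_rarely_false:
  fixes D :: "assignment pmf"
  assumes \<mu>: "0 < \<mu>" "\<mu> \<le> 1" and \<gamma>: "0 < \<gamma>"
    and valid: "validity D \<phi> \<ge> 1 - \<gamma> * \<mu> ^ w / 8"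
    and \<psi>: "\<psi> = filter Q (narrow_clauses n w)"
    and rare: "\<And>C. C \<in> set \<psi> \<Longrightarrow> witness_prob n \<mu> D C \<le> 3 / 2 * witness_threshold n w \<mu> \<gamma>"
  shows "measure_pmf.prob D {x. \<not> cnf_true x (map (reduce \<psi>) \<phi>)} \<le> \<gamma> * \<mu> ^ w / 2"
proof -
  let ?P = "(2 * real n + 1) ^ w"
  have P: "?P > 0" by (simp add: add_nonneg_pos)
  have each: "false_prob D C \<le> 3 * \<gamma> * \<mu> ^ w / (8 * ?P)" if "C \<in> set \<psi>" for C
  proof -
    have C: "length C \<le> w" "set C \<subseteq> literals n" using that narrow_clausesD[of C n w] by (simp_all add: \<psi>)
    then have "card (set C) \<le> w" using card_length[of C] by linarith
    then have "\<mu> ^ w * false_prob D C \<le> \<mu> ^ card (set C) * false_prob D C"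
      using \<mu> by (intro mult_right_mono power_decreasing) (auto simp: false_prob_def)
    also have "\<dots> = witness_prob n \<mu> D C" using \<mu> C by (simp add: witness_prob_eq)
    also have "\<dots> \<le> 3 / 2 * witness_threshold n w \<mu> \<gamma>" by (rule rare[OF that])
    also have "\<dots> = \<mu> ^ w * (3 * \<gamma> * \<mu> ^ w / (8 * ?P))"
      by (simp add: witness_threshold_def power_even_eq power2_eq_square)
    finally show ?thesis using \<mu> by (simp only: mult_le_cancel_left_pos zero_less_power)
  qed
  have "measure_pmf.prob D {x. \<exists>C\<in>set \<psi>. \<not> clause_true x C}
      \<le> real (length \<psi>) * (3 * \<gamma> * \<mu> ^ w / (8 * ?P))"
    using each \<mu> \<gamma> by (intro prob_some_clause_false_le) auto
  also have "\<dots> \<le> ?P * (3 * \<gamma> * \<mu> ^ w / (8 * ?P))"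
    unfolding \<psi> using length_narrow_clauses_filter \<mu> \<gamma> by (intro mult_right_mono) auto
  also have "\<dots> = 3 / 8 * \<gamma> * \<mu> ^ w" using P by simp
  finally have \<psi>_false: "measure_pmf.prob D {x. \<exists>C\<in>set \<psi>. \<not> clause_true x C} \<le> 3 / 8 * \<gamma> * \<mu> ^ w" .
  have "{x. \<not> cnf_true x (map (reduce \<psi>) \<phi>)}
      \<subseteq> {x. \<not> cnf_true x \<phi>} \<union> {x. \<exists>C\<in>set \<psi>. \<not> clause_true x C}"
    using reduce_true by (fastforce simp: cnf_true_def)
  then have "measure_pmf.prob D {x. \<not> cnf_true x (map (reduce \<psi>) \<phi>)}
      \<le> measure_pmf.prob D ({x. \<not> cnf_true x \<phi>} \<union> {x. \<exists>C\<in>set \<psi>. \<not> clause_true x C})"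
    by (intro measure_pmf.finite_measure_mono) auto
  also have "\<dots> \<le> measure_pmf.prob D {x. \<not> cnf_true x \<phi>}
      + measure_pmf.prob D {x. \<exists>C\<in>set \<psi>. \<not> clause_true x C}"
    by (intro measure_Un_le) auto
  also have "\<dots> \<le> \<gamma> * \<mu> ^ w / 2" using \<psi>_false valid by (simp add: validity_compl)
  finally show ?thesis .
qed

text \<open>If \<open>l\<close> were nearly always false given \<open>B\<close>, the clause made of
  \<open>B\<close> and \<open>neg l\<close> would have width exactly \<open>w\<close> and be
  witnessed with probability at most \<open>\<mu> ^ w * g\<close>. It would then be learned and
  would have deleted \<open>l\<close>.\<close>

lemma reduced_wide_clause:
  fixes D :: "assignment pmf"
  assumes \<mu>: "0 < \<mu>" "\<mu> \<le> 1" and "\<beta> \<le> 1" "0 \<le> g" "w \<ge> 1"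
    and gap: "correlation_gap n D w \<beta> (1 - g)"
    and g: "\<mu> ^ w * g \<le> witness_threshold n w \<mu> \<gamma> / 2"
    and complete: "\<And>C'. C' \<in> set (narrow_clauses n w) \<Longrightarrow>
      witness_prob n \<mu> D C' \<le> witness_threshold n w \<mu> \<gamma> / 2 \<Longrightarrow> C' \<in> set \<psi>"
    and C: "set C \<subseteq> literals n" "w \<le> card (set (reduce \<psi> C))"
  shows "false_prob D (reduce \<psi> C) \<le> (1 - \<beta>) ^ w \<or>
    (\<exists>B\<subseteq>set (reduce \<psi> C). card B \<le> w \<and> measure_pmf.prob D (all_false B) \<le> g)"
  unfolding false_prob_eq
proof (rule wide_clause_false_prob[OF gap \<open>\<beta> \<le> 1\<close> \<open>0 \<le> g\<close>])
  show A: "set (reduce \<psi> C) \<subseteq> literals n" using reduce_shrinks C(1) by blast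
  fix B l assume B: "B \<subseteq> set (reduce \<psi> C)" "l \<in> set (reduce \<psi> C)" "l \<notin> B" "neg l \<notin> B" "card B = w - 1"
  show "g < measure_pmf.prob D (all_false (insert (neg l) B))"
  proof (rule ccontr)
    assume "\<not> ?thesis"
    then have small: "measure_pmf.prob D (all_false (insert (neg l) B)) \<le> g" by simp
    have "finite B" using B(1) finite_subset by blast
    then have card: "card (insert (neg l) B) = w" using B \<open>w \<ge> 1\<close> by simp
    have "insert (neg l) B \<subseteq> literals n" using A B by auto
    then obtain C' where C': "C' \<in> set (narrow_clauses n w)" "set C' = insert (neg l) B"
      using ex_narrow_clause[of "insert (neg l) B" n w] card by auto
    have "witness_prob n \<mu> D C' = \<mu> ^ w * measure_pmf.prob D (all_false (insert (neg l) B))"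
      using \<mu> C' narrow_clausesD(2)[OF C'(1)] card by (simp add: witness_prob_eq false_prob_eq)
    also have "\<dots> \<le> \<mu> ^ w * g" using small \<mu> by (intro mult_left_mono) auto
    finally have "C' \<in> set \<psi>" using g C' by (intro complete) auto
    \<comment> \<open>Saturation is used with pivot \<open>neg l\<close>, so the literal it excludes
      is \<open>l\<close> itself.\<close>
    then have "neg (neg l) \<notin> set (reduce \<psi> C)"
      using B C' neg_neq[of l] by (intro reduce_saturated[of C']) (auto dest: sym)
    then show False using B by simp
  qed
qed fact

text \<open>Falsity of \<phi> is inherited by the reduced formula. Of its probability at least
  \<gamma>, narrow subclauses that are nearly always true explain at most \<gamma>/8 and balanced
  wide clauses at most \<gamma>/16, which leaves more than 3/4 of \<gamma>.\<close>

lemma reduced_often_false: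
  fixes D :: "assignment pmf"
  assumes \<mu>: "0 < \<mu>" "\<mu> \<le> 1" and \<gamma>: "0 < \<gamma>" "\<gamma> \<le> 1" and \<beta>: "0 < \<beta>" "\<beta> \<le> 1"
    and \<phi>: "\<phi> \<noteq> []" "cnf_over n \<phi>"
    and w: "w = eval_width (length \<phi>) \<gamma> \<beta>"
    and gap: "correlation_gap n D w \<beta> (1 - \<gamma> * \<mu> ^ w / (8 * real n * (2 * real n + 1) ^ w))"
    and invalid: "validity D \<phi> \<le> 1 - \<gamma>"
    and complete: "\<And>C'. C' \<in> set (narrow_clauses n w) \<Longrightarrow>
      witness_prob n \<mu> D C' \<le> witness_threshold n w \<mu> \<gamma> / 2 \<Longrightarrow> C' \<in> set \<psi>"
  shows "3 / 4 * \<gamma> \<le> measure_pmf.prob D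
    {x. \<exists>C\<in>set (map (reduce \<psi>) \<phi>). card (set C) \<le> w \<and> \<not> clause_true x C}"
proof -
  let ?P = "(2 * real n + 1) ^ w" and ?\<phi>' = "map (reduce \<psi>) \<phi>"
  define g where "g = \<gamma> * \<mu> ^ w / (8 * real n * ?P)"
  have m: "length \<phi> \<ge> 1" using \<phi> by (cases \<phi>) auto
  have w1: "w \<ge> 1" using eval_width_ge(2)[OF m \<gamma> \<beta>] w by simp
  have P: "?P > 0" by (simp add: add_nonneg_pos)
  have g0: "0 \<le> g" using \<mu> \<gamma> P by (simp add: g_def)
  have gP: "?P * g \<le> \<gamma> * \<mu> ^ w / 8"
  \<comment> \<open>For \<open>n = 0\<close> division by zero makes \<open>g\<close> equal to 0, and
    the bound is trivial.\<close>
  proof (cases "n = 0")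
    case False
    then have "?P * g = \<gamma> * \<mu> ^ w / 8 / real n" using P by (simp add: g_def)
    also have "\<dots> \<le> \<gamma> * \<mu> ^ w / 8 / 1" using False \<mu> \<gamma> by (intro divide_left_mono) auto
    finally show ?thesis by simp
  qed (use \<mu> \<gamma> in \<open>simp add: g_def\<close>)
  have "g \<le> \<gamma> * \<mu> ^ w / (8 * ?P)" using gP P by (simp add: field_simps)
  then have "\<mu> ^ w * g \<le> \<mu> ^ w * (\<gamma> * \<mu> ^ w / (8 * ?P))" using \<mu> by (intro mult_left_mono) auto
  also have "\<dots> = witness_threshold n w \<mu> \<gamma> / 2"
    by (simp add: witness_threshold_def power_even_eq power2_eq_square)
  finally have thr: "\<mu> ^ w * g \<le> witness_threshold n w \<mu> \<gamma> / 2" .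
  define b where "b = (1 - \<beta>) ^ w"
  have b0: "0 \<le> b" using \<beta> by (simp add: b_def)
  \<comment> \<open>All narrow clauses that are rarely false are collected, wherever they may occur,
    so this union bound does not depend on the size of \<phi>.\<close>
  define cs where "cs = filter (\<lambda>C. false_prob D C \<le> g) (narrow_clauses n w)"
  define ds where "ds = filter (\<lambda>C. false_prob D C \<le> b) ?\<phi>'"
  let ?N = "{x. \<exists>C\<in>set ?\<phi>'. card (set C) \<le> w \<and> \<not> clause_true x C}"
  have cover: "{x. \<not> cnf_true x \<phi>} \<subseteq> ?N \<union> {x. \<exists>C\<in>set cs. \<not> clause_true x C}
      \<union> {x. \<exists>C\<in>set ds. \<not> clause_true x C}"
  proof
    fix x assume "x \<in> {x. \<not> cnf_true x \<phi>}"
    then obtain C where C: "C \<in> set \<phi>" "\<not> clause_true x C" by (auto simp: cnf_true_def)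
    let ?C = "reduce \<psi> C"
    have false: "\<not> clause_true x ?C" using C reduce_false by blast
    show "x \<in> ?N \<union> {x. \<exists>C\<in>set cs. \<not> clause_true x C} \<union> {x. \<exists>C\<in>set ds. \<not> clause_true x C}"
    proof (cases "card (set ?C) \<le> w")
      case True
      then show ?thesis using C false by auto
    next
      case wide: False
      have "set C \<subseteq> literals n" using C \<phi> by (auto simp: cnf_over_def)
      then consider "false_prob D ?C \<le> b"
        | B where "B \<subseteq> set ?C" "card B \<le> w" "measure_pmf.prob D (all_false B) \<le> g"
        using reduced_wide_clause[OF \<mu> \<beta>(2) g0 w1 gap[folded g_def] thr complete] wide
        unfolding b_def by (metis nat_le_linear)
      then show ?thesis
      proof cases
        case 1
        then show ?thesis using C false by (auto simp: ds_def)
      next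
        case 2
        have "B \<subseteq> literals n"
          using 2 reduce_shrinks[of \<psi> C] \<open>set C \<subseteq> literals n\<close> by (meson order_trans)
        then obtain C' where C': "C' \<in> set (narrow_clauses n w)" "set C' = B"
          using ex_narrow_clause 2 by blast
        then have "C' \<in> set cs" using 2 by (simp add: cs_def false_prob_eq)
        moreover have "\<not> clause_true x C'" using C' 2 false by (auto simp: clause_true_def)
        ultimately show ?thesis by blast
      qed
    qed
  qed
  have "\<gamma> \<le> measure_pmf.prob D {x. \<not> cnf_true x \<phi>}" using invalid by (simp add: validity_compl)
  also have "\<dots> \<le> measure_pmf.prob D (?N \<union> {x. \<exists>C\<in>set cs. \<not> clause_true x C}
      \<union> {x. \<exists>C\<in>set ds. \<not> clause_true x C})"
    using cover by (intro measure_pmf.finite_measure_mono) auto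
  also have "\<dots> \<le> measure_pmf.prob D (?N \<union> {x. \<exists>C\<in>set cs. \<not> clause_true x C})
      + measure_pmf.prob D {x. \<exists>C\<in>set ds. \<not> clause_true x C}"
    by (intro measure_Un_le) auto
  also have "\<dots> \<le> measure_pmf.prob D ?N + measure_pmf.prob D {x. \<exists>C\<in>set cs. \<not> clause_true x C}
      + measure_pmf.prob D {x. \<exists>C\<in>set ds. \<not> clause_true x C}"
    by (intro add_right_mono measure_Un_le) auto
  finally have total: "\<gamma> \<le> measure_pmf.prob D ?N + measure_pmf.prob D {x. \<exists>C\<in>set cs. \<not> clause_true x C}
      + measure_pmf.prob D {x. \<exists>C\<in>set ds. \<not> clause_true x C}" .
  have "measure_pmf.prob D {x. \<exists>C\<in>set cs. \<not> clause_true x C} \<le> real (length cs) * g"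
    using g0 by (intro prob_some_clause_false_le) (auto simp: cs_def)
  also have "\<dots> \<le> ?P * g"
    unfolding cs_def using length_narrow_clauses_filter g0 by (intro mult_right_mono) auto
  also have "\<dots> \<le> \<gamma> * \<mu> ^ w / 8" by (rule gP)
  also have "\<dots> \<le> \<gamma> / 8" using \<mu> \<gamma> by (simp add: mult_left_le power_le_one)
  finally have cs: "measure_pmf.prob D {x. \<exists>C\<in>set cs. \<not> clause_true x C} \<le> \<gamma> / 8" .
  let ?m = "real (length \<phi>)"
  have "1 \<le> ?m" using m by linarith
  then have \<gamma>_m: "\<gamma> / ?m \<le> 1" using \<gamma> by (simp add: divide_le_eq)
  have "measure_pmf.prob D {x. \<exists>C\<in>set ds. \<not> clause_true x C} \<le> real (length ds) * b"
    using b0 by (intro prob_some_clause_false_le) (auto simp: ds_def)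
  also have "\<dots> \<le> ?m * b"
    using b0 length_filter_le[of _ ?\<phi>'] by (intro mult_right_mono) (auto simp: ds_def)
  also have "\<dots> \<le> ?m * (\<gamma> / (4 * ?m))\<^sup>2"
    unfolding b_def w using balanced_width_bound[OF m \<gamma> \<beta>] by (intro mult_left_mono) auto
  also have "\<dots> = \<gamma> * (\<gamma> / ?m) / 16" using m by (simp add: field_simps power2_eq_square)
  also have "\<dots> \<le> \<gamma> * 1 / 16"
    using \<gamma> \<gamma>_m by (intro divide_right_mono mult_left_mono) auto
  finally have "measure_pmf.prob D {x. \<exists>C\<in>set ds. \<not> clause_true x C} \<le> \<gamma> / 16" by simp
  then show ?thesis using total cs \<gamma> by linarith
qed

section \<open>Error probability of the whole algorithm\<close>

lemma cnf_eval_accepts: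
  fixes D :: "assignment pmf"
  assumes \<mu>: "0 < \<mu>" "\<mu> \<le> 1" and \<gamma>: "0 < \<gamma>" "\<gamma> \<le> 1" and \<beta>: "0 < \<beta>" "\<beta> \<le> 1"
    and \<delta>: "0 < \<delta>" "\<delta> < 1" and \<phi>: "\<phi> \<noteq> []" "cnf_over n \<phi>"
    and w: "w = eval_width (length \<phi>) \<gamma> \<beta>"
    and valid: "validity D \<phi> \<ge> 1 - \<gamma> * \<mu> ^ w / 8"
  shows "measure_pmf.prob
      (replicate_pmf (learn_samples n w \<mu> \<gamma> \<delta> + test_samples w \<mu> \<gamma> \<delta>) (masked n \<mu> D))
      {\<rho>s. result (cnf_eval n \<mu> \<phi> \<delta> \<gamma> \<beta> \<rho>s) = Accept} \<ge> 1 - \<delta>"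
proof -
  let ?m1 = "test_samples w \<mu> \<gamma> \<delta>" and ?M = "masked n \<mu> D"
  have "length \<phi> \<ge> 1" using \<phi> by (cases \<phi>) auto
  then have w1: "w \<ge> 1" using eval_width_ge(2)[OF _ \<gamma> \<beta>] w by fastforce
  have second: "measure_pmf.prob (replicate_pmf ?m1 ?M)
      {\<sigma>s. \<not> result (cnf_eval n \<mu> \<phi> \<delta> \<gamma> \<beta> (\<rho>s @ \<sigma>s)) = Accept} \<le> \<delta> / 2"
    if len: "length \<rho>s = learn_samples n w \<mu> \<gamma> \<delta>"
      and good: "\<forall>C\<in>set (learned n w \<mu> \<gamma> \<delta> \<rho>s).
        witness_prob n \<mu> D C \<le> 3 / 2 * witness_threshold n w \<mu> \<gamma>" for \<rho>s
  proof -
    let ?\<phi>' = "map (reduce (learned n w \<mu> \<gamma> \<delta> \<rho>s)) \<phi>"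
    let ?p = "measure_pmf.prob ?M {\<rho>. falsified ?\<phi>' \<rho>}" and ?\<epsilon> = "\<mu> ^ w * \<gamma> / 8"
    have "?p \<le> measure_pmf.prob D {x. \<not> cnf_true x ?\<phi>'}"
      using \<mu> \<phi> by (intro prob_falsified_le cnf_over_reduce) auto
    also have "\<dots> \<le> \<gamma> * \<mu> ^ w / 2"
      using good by (intro reduced_rarely_false[OF \<mu> \<gamma>(1) valid learned_def]) auto
    \<comment> \<open>In units of \<open>\<mu> ^ w * \<gamma>\<close>: 1/2 + 1/8 = 5/8, so a
      rejection means an upward deviation of at least \<open>?\<epsilon>\<close>.\<close>
    finally have "?p + ?\<epsilon> \<le> 5 * \<mu> ^ w * \<gamma> / 8" by (simp add: field_simps)
    then have le: "real ?m1 * (?p + ?\<epsilon>) \<le> 5 * \<mu> ^ w * \<gamma> / 8 * real ?m1"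
      by (subst mult.commute) (rule mult_right_mono, simp_all)
    have "measure_pmf.prob (replicate_pmf ?m1 ?M)
        {\<sigma>s. \<not> result (cnf_eval n \<mu> \<phi> \<delta> \<gamma> \<beta> (\<rho>s @ \<sigma>s)) = Accept}
      \<le> measure_pmf.prob (replicate_pmf ?m1 ?M)
        {\<sigma>s. real (length (filter (falsified ?\<phi>') \<sigma>s)) \<ge> real ?m1 * (?p + ?\<epsilon>)}"
    \<comment> \<open>The verdict is described by \<open>result_cnf_eval\<close> for samples of the
      prescribed length, so the inclusion of events is shown on the support.\<close>
    proof (rule measure_pmf.finite_measure_mono_AE)
      show "AE \<sigma>s in replicate_pmf ?m1 ?M.
          \<sigma>s \<in> {\<sigma>s. \<not> result (cnf_eval n \<mu> \<phi> \<delta> \<gamma> \<beta> (\<rho>s @ \<sigma>s)) = Accept} \<longrightarrow>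
          \<sigma>s \<in> {\<sigma>s. real (length (filter (falsified ?\<phi>') \<sigma>s)) \<ge> real ?m1 * (?p + ?\<epsilon>)}"
        unfolding AE_measure_pmf_iff
      proof (intro ballI impI)
        fix \<sigma>s assume "\<sigma>s \<in> set_pmf (replicate_pmf ?m1 ?M)"
          and rej: "\<sigma>s \<in> {\<sigma>s. \<not> result (cnf_eval n \<mu> \<phi> \<delta> \<gamma> \<beta> (\<rho>s @ \<sigma>s)) = Accept}"
        then have "length \<sigma>s = ?m1" by (simp add: set_replicate_pmf)
        with rej have "real (length (filter (falsified ?\<phi>') \<sigma>s)) > 5 * \<mu> ^ w * \<gamma> / 8 * real ?m1"
          using result_cnf_eval[OF _ _ w len, of \<sigma>s] \<mu> \<gamma>
          by (auto split: if_splits)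
        then show "\<sigma>s \<in> {\<sigma>s. real (length (filter (falsified ?\<phi>') \<sigma>s)) \<ge> real ?m1 * (?p + ?\<epsilon>)}"
          using le by simp
      qed
    qed simp
    also have "\<dots> \<le> exp (- 2 * real ?m1 * ?\<epsilon>\<^sup>2)" using \<mu> \<gamma> by (intro hoeffding_count_ge) simp
    also have "\<dots> \<le> \<delta> / 2" using \<mu> \<gamma> \<delta> by (intro test_samples_deviation)
    finally show ?thesis .
  qed
  have "0 \<le> \<delta> / 2" using \<delta> by simp
  from replicate_pmf_two_stage[where b = ?m1
      and E = "\<lambda>\<rho>s. result (cnf_eval n \<mu> \<phi> \<delta> \<gamma> \<beta> \<rho>s) = Accept",
      OF learned_sound[OF \<mu>(1) \<gamma>(1) \<delta> w1] second this]
  show ?thesis by simp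
qed

lemma cnf_eval_rejects:
  fixes D :: "assignment pmf"
  assumes \<mu>: "0 < \<mu>" "\<mu> \<le> 1" and \<gamma>: "0 < \<gamma>" "\<gamma> \<le> 1" and \<beta>: "0 < \<beta>" "\<beta> \<le> 1"
    and \<delta>: "0 < \<delta>" "\<delta> < 1" and \<phi>: "\<phi> \<noteq> []" "cnf_over n \<phi>"
    and w: "w = eval_width (length \<phi>) \<gamma> \<beta>"
    and gap: "correlation_gap n D w \<beta> (1 - \<gamma> * \<mu> ^ w / (8 * real n * (2 * real n + 1) ^ w))"
    and invalid: "validity D \<phi> \<le> 1 - \<gamma>"
  shows "measure_pmf.prob
      (replicate_pmf (learn_samples n w \<mu> \<gamma> \<delta> + test_samples w \<mu> \<gamma> \<delta>) (masked n \<mu> D))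
      {\<rho>s. result (cnf_eval n \<mu> \<phi> \<delta> \<gamma> \<beta> \<rho>s) = Reject} \<ge> 1 - \<delta>"
proof -
  let ?m1 = "test_samples w \<mu> \<gamma> \<delta>" and ?M = "masked n \<mu> D"
  have "length \<phi> \<ge> 1" using \<phi> by (cases \<phi>) auto
  then have w1: "w \<ge> 1" using eval_width_ge(2)[OF _ \<gamma> \<beta>] w by fastforce
  have second: "measure_pmf.prob (replicate_pmf ?m1 ?M)
      {\<sigma>s. \<not> result (cnf_eval n \<mu> \<phi> \<delta> \<gamma> \<beta> (\<rho>s @ \<sigma>s)) = Reject} \<le> \<delta> / 2"
    if len: "length \<rho>s = learn_samples n w \<mu> \<gamma> \<delta>"
      and good: "\<forall>C\<in>set (narrow_clauses n w).
       witness_prob n \<mu> D C \<le> witness_threshold n w \<mu> \<gamma> / 2 \<longrightarrow> C \<in> set (learned n w \<mu> \<gamma> \<delta> \<rho>s)" for \<rho>s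
  proof -
    let ?\<phi>' = "map (reduce (learned n w \<mu> \<gamma> \<delta> \<rho>s)) \<phi>"
    let ?p = "measure_pmf.prob ?M {\<rho>. falsified ?\<phi>' \<rho>}" and ?\<epsilon> = "\<mu> ^ w * \<gamma> / 8"
    have "3 / 4 * \<gamma> \<le> measure_pmf.prob D {x. \<exists>C\<in>set ?\<phi>'. card (set C) \<le> w \<and> \<not> clause_true x C}"
      using good by (intro reduced_often_false[OF \<mu> \<gamma> \<beta> \<phi> w gap invalid]) auto
    then have "\<mu> ^ w * (3 / 4 * \<gamma>)
        \<le> \<mu> ^ w * measure_pmf.prob D {x. \<exists>C\<in>set ?\<phi>'. card (set C) \<le> w \<and> \<not> clause_true x C}"
      using \<mu> by (intro mult_left_mono) auto
    also have "\<dots> \<le> ?p" using \<mu> \<phi> by (intro prob_falsified_ge cnf_over_reduce) auto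
    \<comment> \<open>In the same units: 3/4 - 1/8 = 5/8, so an acceptance means a downward
      deviation.\<close>
    finally have "5 * \<mu> ^ w * \<gamma> / 8 \<le> ?p - ?\<epsilon>" by (simp add: field_simps)
    then have le: "5 * \<mu> ^ w * \<gamma> / 8 * real ?m1 \<le> real ?m1 * (?p - ?\<epsilon>)"
      by (subst mult.commute) (rule mult_left_mono, simp_all)
    have "measure_pmf.prob (replicate_pmf ?m1 ?M)
        {\<sigma>s. \<not> result (cnf_eval n \<mu> \<phi> \<delta> \<gamma> \<beta> (\<rho>s @ \<sigma>s)) = Reject}
      \<le> measure_pmf.prob (replicate_pmf ?m1 ?M)
        {\<sigma>s. real (length (filter (falsified ?\<phi>') \<sigma>s)) \<le> real ?m1 * (?p - ?\<epsilon>)}"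
    proof (rule measure_pmf.finite_measure_mono_AE)
      show "AE \<sigma>s in replicate_pmf ?m1 ?M.
          \<sigma>s \<in> {\<sigma>s. \<not> result (cnf_eval n \<mu> \<phi> \<delta> \<gamma> \<beta> (\<rho>s @ \<sigma>s)) = Reject} \<longrightarrow>
          \<sigma>s \<in> {\<sigma>s. real (length (filter (falsified ?\<phi>') \<sigma>s)) \<le> real ?m1 * (?p - ?\<epsilon>)}"
        unfolding AE_measure_pmf_iff
      proof (intro ballI impI)
        fix \<sigma>s assume "\<sigma>s \<in> set_pmf (replicate_pmf ?m1 ?M)"
          and acc: "\<sigma>s \<in> {\<sigma>s. \<not> result (cnf_eval n \<mu> \<phi> \<delta> \<gamma> \<beta> (\<rho>s @ \<sigma>s)) = Reject}"
        then have "length \<sigma>s = ?m1" by (simp add: set_replicate_pmf)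
        with acc have "real (length (filter (falsified ?\<phi>') \<sigma>s)) \<le> 5 * \<mu> ^ w * \<gamma> / 8 * real ?m1"
          using result_cnf_eval[OF _ _ w len, of \<sigma>s] \<mu> \<gamma>
          by (auto split: if_splits)
        then show "\<sigma>s \<in> {\<sigma>s. real (length (filter (falsified ?\<phi>') \<sigma>s)) \<le> real ?m1 * (?p - ?\<epsilon>)}"
          using le by simp
      qed
    qed simp
    also have "\<dots> \<le> exp (- 2 * real ?m1 * ?\<epsilon>\<^sup>2)" using \<mu> \<gamma> by (intro hoeffding_count_le) simp
    also have "\<dots> \<le> \<delta> / 2" using \<mu> \<gamma> \<delta> by (intro test_samples_deviation)
    finally show ?thesis .
  qed
  have "0 \<le> \<delta> / 2" using \<delta> by simp
  from replicate_pmf_two_stage[where b = ?m1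
      and E = "\<lambda>\<rho>s. result (cnf_eval n \<mu> \<phi> \<delta> \<gamma> \<beta> \<rho>s) = Reject",
      OF learned_complete[OF \<mu>(1) \<gamma>(1) \<delta> w1] second this]
  show ?thesis by simp
qed

subsection \<open>Running time\<close>

lemma steps_length_t [simp]: "steps (length_t as) = length as + 1"
  by (induction as) auto

lemma steps_append_t [simp]: "steps (append_t as bs) = length as + 1"
  by (induction as) auto

lemma steps_split_t: "steps (split_t k as) \<le> k + 1"
  by (induction k as rule: split_t.induct) auto

lemma steps_map_t:
  assumes "\<And>a. a \<in> set as \<Longrightarrow> steps (f a) \<le> b"
  shows "steps (map_t f as) \<le> length as * (b + 1) + 1"
  using assms by (induction as) (force simp: add_mono)+

lemma steps_pred_ops:
  assumes "\<And>a. a \<in> set as \<Longrightarrow> steps (P a) \<le> b"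
  shows steps_filter_t: "steps (filter_t P as) \<le> length as * (b + 1) + 1"
    and steps_count_t: "steps (count_t P as) \<le> length as * (b + 1) + 1"
    and steps_all_t: "steps (all_t P as) \<le> length as * (b + 1) + 1"
    and steps_ex_t: "steps (ex_t P as) \<le> length as * (b + 1) + 1"
  using assms by (induction as) (force simp: add_mono)+

text \<open>The cost of an iteration depends on the state, so a uniform bound is asked only under an
  invariant; in the applications it says that the current clause has length at most
  \<open>K\<close>.\<close>

lemma steps_fold_t:
  assumes "I s"
    and "\<And>a s. a \<in> set as \<Longrightarrow> I s \<Longrightarrow> steps (f a s) \<le> b \<and> I (result (f a s))"
  shows "steps (fold_t f as s) \<le> length as * (b + 1) + 1"
  using assms
proof (induction as arbitrary: s)
  case (Cons a as)
  have "steps (f a s) \<le> b" "I (result (f a s))" using Cons.prems by auto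
  moreover from this have "steps (fold_t f as (result (f a s))) \<le> length as * (b + 1) + 1"
    using Cons.IH Cons.prems by simp
  ultimately show ?case by simp
qed simp

lemma steps_mem_t: "steps (mem_t l C) \<le> 2 * length C + 1"
  using steps_ex_t[of C "\<lambda>l'. tick (ret (l' = l))" 1] by (simp add: mem_t_def)

lemma steps_delete_t: "steps (delete_t l C) \<le> 2 * length C + 1"
  using steps_filter_t[of C "\<lambda>l'. tick (ret (l' \<noteq> l))" 1] by (simp add: delete_t_def)

lemma steps_witnessed_false_t: "steps (witnessed_false_t \<rho> C) \<le> 2 * length C + 1"
  using steps_all_t[of C "\<lambda>l. tick (ret (lit_witnessed_false \<rho> l))" 1]
  by (simp add: witnessed_false_t_def)

lemma steps_literals_t [simp]: "steps (literals_t n) = n + 1"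
  by (induction n) auto

text \<open>In the recursive case the extra work of extending and appending is at most
  \<open>3 + 3 * ?N ^ w\<close>, hence the constant 6. The rest is the expansion of
  \<open>(?N + 1)\<^sup>2 * ?N ^ w\<close>.\<close>

lemma steps_clauses_t: "steps (clauses_t w ls) \<le> 6 * (length ls + 1) ^ (w + 1)"
proof (induction w ls rule: clauses_t.induct)
  case (3 w l ls)
  let ?N = "length ls + 1" and ?X = "result (clauses_t w ls)"
  have len: "length ?X \<le> ?N ^ w" by (rule length_result_clauses_t)
  have map: "steps (map_t (\<lambda>C. tick (ret (l # C))) ?X) \<le> length ?X * 2 + 1"
    using steps_map_t[of ?X "\<lambda>C. tick (ret (l # C))" 1] by simp
  have "steps (clauses_t (Suc w) (l # ls))
      = 1 + steps (clauses_t w ls) + steps (map_t (\<lambda>C. tick (ret (l # C))) ?X)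
        + steps (clauses_t (Suc w) ls) + (length ?X + 1)"
    by simp
  also have "\<dots> \<le> 1 + 6 * ?N ^ (w + 1) + (2 * ?N ^ w + 1) + 6 * ?N ^ (w + 2) + (?N ^ w + 1)"
    using 3 len map by simp
  also have "\<dots> \<le> 6 * (?N ^ w + 2 * ?N ^ (w + 1) + ?N ^ (w + 2))"
  proof -
    have "1 + 6 * a + (2 * b + 1) + 6 * d + (b + 1) \<le> 6 * (b + 2 * a + d)" if "1 \<le> b" for a b d :: nat
      using that by simp
    moreover have "1 \<le> ?N ^ w" by (rule one_le_power) simp
    ultimately show ?thesis by blast
  qed
  also have "\<dots> = 6 * ((?N + 1)\<^sup>2 * ?N ^ w)" by (simp add: algebra_simps power2_eq_square)
  also have "\<dots> \<le> 6 * ((?N + 1)\<^sup>2 * (?N + 1) ^ w)" by (intro mult_left_mono power_mono) auto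
  also have "\<dots> = 6 * (length (l # ls) + 1) ^ (Suc w + 1)"
    by (simp add: power2_eq_square algebra_simps)
  finally show ?case .
qed auto

lemma steps_learn_t:
  "steps (learn_t n w \<theta> \<rho>s) \<le> n + 2 + 6 * (2 * n + 1) ^ (w + 1)
     + (2 * n + 1) ^ w * (length \<rho>s * (2 * w + 2) + 3)"
proof -
  have count: "steps (count_t (\<lambda>\<rho>. witnessed_false_t \<rho> C) \<rho>s) \<le> length \<rho>s * (2 * w + 2) + 1"
    if "C \<in> set (narrow_clauses n w)" for C
  proof -
    have "steps (witnessed_false_t \<rho> C) \<le> 2 * w + 1" for \<rho>
      using steps_witnessed_false_t[of \<rho> C] narrow_clausesD(1)[OF that] by linarith
    then have "steps (count_t (\<lambda>\<rho>. witnessed_false_t \<rho> C) \<rho>s) \<le> length \<rho>s * (2 * w + 1 + 1) + 1"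
      by (intro steps_count_t)
    then show ?thesis by simp
  qed
  let ?P = "\<lambda>C. do {
       k \<leftarrow> count_t (\<lambda>\<rho>. witnessed_false_t \<rho> C) \<rho>s;
       tick (ret (real k \<le> \<theta>)) }"
  have "steps (filter_t ?P (narrow_clauses n w))
      \<le> length (narrow_clauses n w) * (length \<rho>s * (2 * w + 2) + 2 + 1) + 1"
    using count by (intro steps_filter_t) simp
  also have "\<dots> \<le> (2 * n + 1) ^ w * (length \<rho>s * (2 * w + 2) + 3) + 1"
    by (intro add_right_mono mult_mono length_narrow_clauses) auto
  finally show ?thesis
    using steps_clauses_t[of w "result (literals_t n)"]
    by (simp add: learn_t_def narrow_clauses_def)
qed

text \<open>Each of at most \<open>w\<close> iterations scans \<open>C'\<close> twice, performs up
  to \<open>w + 1\<close> membership tests in the current clause and deletes from it at most once.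
  That clause never grows beyond \<open>K\<close>.\<close>

lemma steps_reduce_by_t:
  assumes "length C' \<le> w" "length C \<le> K"
  shows "steps (reduce_by_t C' C) \<le> w * (4 * w + (w + 1) * (2 * K + 2) + 2 * K + 5) + 1"
proof -
  let ?f = "\<lambda>l C. do {
     C'' \<leftarrow> delete_t l C';
     taut \<leftarrow> mem_t (neg l) C'';
     sub \<leftarrow> all_t (\<lambda>l'. mem_t l' C) (neg l # C'');
     if \<not> taut \<and> sub then delete_t (neg l) C else ret C }"
  let ?b = "4 * w + (w + 1) * (2 * K + 2) + 2 * K + 4"
  have "steps (?f l D) \<le> ?b \<and> length (result (?f l D)) \<le> K" if D: "length D \<le> K" for l D
  proof -
    let ?C = "removeAll l C'"
    have C: "length ?C \<le> w" using assms(1) length_removeAll_less_eq[of l C'] by linarith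
    have 1: "steps (delete_t l C') \<le> 2 * w + 1"
      using steps_delete_t[of l C'] assms(1) by linarith
    have 2: "steps (mem_t (neg l) ?C) \<le> 2 * w + 1"
      using steps_mem_t[of "neg l" ?C] C by linarith
    have "steps (all_t (\<lambda>l'. mem_t l' D) (neg l # ?C)) \<le> length (neg l # ?C) * (2 * K + 1 + 1) + 1"
      
    proof (rule steps_all_t)
      show "steps (mem_t l' D) \<le> 2 * K + 1" for l'
        using steps_mem_t[of l' D] D by linarith
    qed
    also have "\<dots> \<le> (w + 1) * (2 * K + 2) + 1" using C by (intro add_right_mono mult_mono) auto
    finally have 3: "steps (all_t (\<lambda>l'. mem_t l' D) (neg l # ?C)) \<le> (w + 1) * (2 * K + 2) + 1" .
    have 4: "steps (delete_t (neg l) D) \<le> 2 * K + 1"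
      using steps_delete_t[of "neg l" D] D by linarith
    have 5: "length (removeAll (neg l) D) \<le> K"
      using D length_removeAll_less_eq[of "neg l" D] by linarith
    show ?thesis
      using 1 2 3 4 5 D by (simp del: all_t.simps)
  qed
  then have "steps (fold_t ?f C' C) \<le> length C' * (?b + 1) + 1"
    using assms(2) by (intro steps_fold_t[where I = "\<lambda>D. length D \<le> K"]) auto
  also have "\<dots> \<le> w * (4 * w + (w + 1) * (2 * K + 2) + 2 * K + 5) + 1"
    using assms(1) by (intro add_right_mono mult_mono) auto
  finally show ?thesis by (simp add: reduce_by_t_def)
qed

lemma steps_reduce_t:
  assumes "\<And>C'. C' \<in> set \<psi> \<Longrightarrow> length C' \<le> w" "length C \<le> K"
  shows "steps (reduce_t \<psi> C)
    \<le> length \<psi> * (w * (4 * w + (w + 1) * (2 * K + 2) + 2 * K + 5) + 2) + 1"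
proof -
  let ?b = "w * (4 * w + (w + 1) * (2 * K + 2) + 2 * K + 5) + 1"
  have "steps (reduce_by_t C' D) \<le> ?b \<and> length (result (reduce_by_t C' D)) \<le> K"
    if "C' \<in> set \<psi>" "length D \<le> K" for C' D
    using steps_reduce_by_t[OF assms(1)[OF that(1)] that(2)] reduce_by_shrinks[of C' D] that
    by simp
  then have "steps (fold_t reduce_by_t \<psi> C) \<le> length \<psi> * (?b + 1) + 1"
    using assms(2) by (intro steps_fold_t[where I = "\<lambda>D. length D \<le> K"]) auto
  then show ?thesis by (simp add: reduce_t_def)
qed

lemma steps_test_t:
  assumes "\<And>C. C \<in> set \<phi> \<Longrightarrow> length C \<le> K"
  shows "steps (test_t \<phi> \<theta> k \<rho>s) \<le> length \<rho>s * (length \<phi> * (2 * K + 2) + 3) + 1"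
proof -
  have ex: "steps (ex_t (witnessed_false_t \<rho>) \<phi>) \<le> length \<phi> * (2 * K + 2) + 1" for \<rho>
  proof -
    have "steps (witnessed_false_t \<rho> C) \<le> 2 * K + 1" if "C \<in> set \<phi>" for C
      using steps_witnessed_false_t[of \<rho> C] assms[OF that] by linarith
    from steps_ex_t[of \<phi> "witnessed_false_t \<rho>", OF this] show ?thesis by simp
  qed
  show ?thesis
  proof (induction \<rho>s arbitrary: k)
    case (Cons \<rho> \<rho>s)
    let ?k = "if \<exists>C\<in>set \<phi>. witnessed_false \<rho> C then Suc k else k"
    have "steps (test_t \<phi> \<theta> k (\<rho> # \<rho>s))
        \<le> steps (ex_t (witnessed_false_t \<rho>) \<phi>) + 2 + steps (test_t \<phi> \<theta> ?k \<rho>s)"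
      by simp
    then show ?case using ex[of \<rho>] Cons.IH[of ?k] by simp
  qed simp
qed

text \<open>The bound holds for input lists of any length, since only a prefix of
  \<open>m0 + m1\<close> samples is read.\<close>

lemma steps_cnf_eval:
  fixes \<phi> :: cnf
  defines "m \<equiv> length \<phi>" and "K \<equiv> cnf_size \<phi>"
  assumes w: "w = eval_width (length \<phi>) \<gamma> \<beta>"
    and m0: "m0 = learn_samples n w \<mu> \<gamma> \<delta>" and m1: "m1 = test_samples w \<mu> \<gamma> \<delta>"
  shows "steps (cnf_eval n \<mu> \<phi> \<delta> \<gamma> \<beta> \<rho>s) \<le> m + 12 + m0 + m1 + n + 6 * (2 * n + 1) ^ (w + 1)
    + (2 * n + 1) ^ w * (m0 * (2 * w + 2) + 3)
    + m * ((2 * n + 1) ^ w * (w * (4 * w + (w + 1) * (2 * K + 2) + 2 * K + 5) + 2) + 2)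
    + m1 * (m * (2 * K + 2) + 3)"
proof -
  define \<theta>\<^sub>0 where "\<theta>\<^sub>0 = \<gamma> * \<mu> ^ (2 * w) / (4 * (2 * real n + 1) ^ w) * real m0"
  define \<theta>\<^sub>1 where "\<theta>\<^sub>1 = 5 * \<mu> ^ w * \<gamma> / 8 * real m1"
  define \<psi> where "\<psi> = result (learn_t n w \<theta>\<^sub>0 (take m0 \<rho>s))"
  let ?\<phi>' = "map (reduce \<psi>) \<phi>"
  let ?r = "(2 * n + 1) ^ w * (w * (4 * w + (w + 1) * (2 * K + 2) + 2 * K + 5) + 2) + 1"
  have K: "length C \<le> K" if "C \<in> set \<phi>" for C
    using member_le_sum_list[of "length C" "map length \<phi>"] that by (simp add: K_def cnf_size_def)
  have total: "steps (cnf_eval n \<mu> \<phi> \<delta> \<gamma> \<beta> \<rho>s) = m + 6 + steps (split_t m0 \<rho>s)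
      + steps (learn_t n w \<theta>\<^sub>0 (take m0 \<rho>s)) + steps (map_t (reduce_t \<psi>) \<phi>)
      + steps (split_t m1 (drop m0 \<rho>s)) + steps (test_t ?\<phi>' \<theta>\<^sub>1 0 (take m1 (drop m0 \<rho>s)))"
    by (simp add: cnf_eval_def m_def w[symmetric] m0[symmetric] m1[symmetric]
        \<theta>\<^sub>0_def \<theta>\<^sub>1_def \<psi>_def)
  have learn: "steps (learn_t n w \<theta>\<^sub>0 (take m0 \<rho>s)) \<le> n + 2 + 6 * (2 * n + 1) ^ (w + 1)
      + (2 * n + 1) ^ w * (m0 * (2 * w + 2) + 3)"
  proof -
    have "(2 * n + 1) ^ w * (length (take m0 \<rho>s) * (2 * w + 2) + 3)
        \<le> (2 * n + 1) ^ w * (m0 * (2 * w + 2) + 3)"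
      by (intro mult_left_mono add_right_mono mult_right_mono) auto
    then show ?thesis using steps_learn_t[of n w \<theta>\<^sub>0 "take m0 \<rho>s"] by linarith
  qed
  have \<psi>: "length \<psi> \<le> (2 * n + 1) ^ w" "\<And>C'. C' \<in> set \<psi> \<Longrightarrow> length C' \<le> w"
    unfolding \<psi>_def result_learn_t
    using length_narrow_clauses length_filter_le order_trans narrow_clausesD(1) by (blast, auto)
  have "steps (reduce_t \<psi> C) \<le> ?r" if "C \<in> set \<phi>" for C
    using steps_reduce_t[OF \<psi>(2) K[OF that]] \<psi>(1)
    by (meson add_le_mono1 le_trans mult_le_mono1)
  from steps_map_t[of \<phi> "reduce_t \<psi>", OF this] have map: "steps (map_t (reduce_t \<psi>) \<phi>) \<le> m * (?r + 1) + 1"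
    by (simp add: m_def)
  have "length C \<le> K" if "C \<in> set ?\<phi>'" for C
    using that K reduce_shrinks[of \<psi>] by (fastforce intro: order.trans)
  from steps_test_t[of ?\<phi>', OF this, of \<theta>\<^sub>1 0 "take m1 (drop m0 \<rho>s)"]
  have "steps (test_t ?\<phi>' \<theta>\<^sub>1 0 (take m1 (drop m0 \<rho>s)))
      \<le> length (take m1 (drop m0 \<rho>s)) * (m * (2 * K + 2) + 3) + 1"
    by (simp add: m_def)
  also have "\<dots> \<le> m1 * (m * (2 * K + 2) + 3) + 1"
    by (intro add_right_mono mult_right_mono) auto
  finally have test: "steps (test_t ?\<phi>' \<theta>\<^sub>1 0 (take m1 (drop m0 \<rho>s)))
      \<le> m1 * (m * (2 * K + 2) + 3) + 1" .
  show ?thesis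
    using total learn map test steps_split_t[of m0 \<rho>s] steps_split_t[of m1 "drop m0 \<rho>s"]
    by simp
qed

section \<open>From the step count to a quasipolynomial bound\<close>

lemma mult_le_power_add:
  fixes T :: real
  assumes "x \<le> T ^ a" "y \<le> T ^ b" "0 \<le> y" "0 \<le> T" "c = a + b"
  shows "x * y \<le> T ^ c"
  using mult_mono[OF assms(1,2)] assms(3-5) by (simp add: power_add)

text \<open>A sum costs one extra power and a product adds exponents, so the estimates below reduce
  to bookkeeping of exponents of one base.\<close>

lemma add_le_power_Suc:
  fixes T :: real
  assumes "x \<le> T ^ a" "y \<le> T ^ a" "2 \<le> T"
  shows "x + y \<le> T ^ Suc a"
proof -
  have "x + y \<le> 2 * T ^ a" using assms by simp
  also have "\<dots> \<le> T * T ^ a" using assms by (intro mult_right_mono) auto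
  finally show ?thesis by simp
qed

text \<open>The dominant term is counting witnesses for all narrow clauses: exponents 2 for
  \<open>P\<close>, 13 for \<open>m0\<close>, 2 for \<open>2 * w + 2\<close> and 1 for the added
  constant give 18. The base 64 absorbs the numerical factors and gives 19.\<close>

lemma step_count_le_power:
  fixes T n w m K P Q m0 m1 :: real
  assumes T: "64 \<le> T"
    and nonneg: "0 \<le> n" "0 \<le> w" "0 \<le> m" "0 \<le> K" "0 \<le> P" "0 \<le> m0" "0 \<le> m1"
    and le: "n \<le> T" "w \<le> T" "m \<le> T" "K \<le> T" "P \<le> T ^ 2" "Q \<le> T ^ 3" "m0 \<le> T ^ 13" "m1 \<le> T ^ 6"
  shows "m + 12 + m0 + m1 + n + 6 * Q + P * (m0 * (2 * w + 2) + 3)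
    + m * (P * (w * (4 * w + (w + 1) * (2 * K + 2) + 2 * K + 5) + 2) + 2)
    + m1 * (m * (2 * K + 2) + 3) \<le> T ^ 19"
proof -
  have pow: "64 \<le> T ^ a" if "a \<ge> 1" for a
    using power_increasing[OF that, of T] T by simp
  have mono: "T ^ a \<le> T ^ b" if "a \<le> b" for a b using that T by (intro power_increasing) auto
  have le1: "n \<le> T ^ 1" "w \<le> T ^ 1" "m \<le> T ^ 1" "K \<le> T ^ 1" using le by simp_all
  have lin: "2 * x + 2 \<le> T ^ 2" if "x \<le> T" for x
  proof -
    have "2 * x + 2 \<le> 64 * T" using that T by simp
    also have "\<dots> \<le> T ^ 2" using T by (simp add: power2_eq_square)
    finally show ?thesis .
  qed
  have A: "m0 * (2 * w + 2) + 3 \<le> T ^ 16"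
  proof -
    have "m0 * (2 * w + 2) \<le> T ^ 15"
      by (rule mult_le_power_add[where a = 13 and b = 2]) (use lin[of w] le nonneg T in auto)
    then have "m0 * (2 * w + 2) + 3 \<le> T ^ Suc 15"
      using pow[of 15] T by (intro add_le_power_Suc) auto
    then show ?thesis by (simp add: numeral_eq_Suc)
  qed
  have A': "P * (m0 * (2 * w + 2) + 3) \<le> T ^ 18"
    using mult_le_power_add[OF le(5) A, of 18] nonneg T by simp
  have B: "m * (2 * K + 2) + 3 \<le> T ^ 4"
  proof -
    have "m * (2 * K + 2) \<le> T ^ 3"
      by (rule mult_le_power_add[where a = 1 and b = 2]) (use lin[of K] le1 le nonneg T in auto)
    then have "m * (2 * K + 2) + 3 \<le> T ^ Suc 3"
      using pow[of 3] T by (intro add_le_power_Suc) auto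
    then show ?thesis by (simp add: numeral_eq_Suc)
  qed
  have B': "m1 * (m * (2 * K + 2) + 3) \<le> T ^ 10"
    using mult_le_power_add[OF le(8) B, of 10] nonneg T by simp
  have C: "4 * w + (w + 1) * (2 * K + 2) + 2 * K + 5 \<le> T ^ 5"
  proof -
    have "w + 1 \<le> T ^ 2" using lin[of w] le nonneg by simp
    then have "(w + 1) * (2 * K + 2) \<le> T ^ 4"
      by (rule mult_le_power_add[where a = 2 and b = 2]) (use lin[of K] le nonneg T in auto)
    moreover have "4 * w + 2 * K + 5 \<le> T ^ 4"
    proof -
      have "4 * w + 2 * K + 5 \<le> 64 * T" using le T by simp
      also have "\<dots> \<le> T ^ 2" using T by (simp add: power2_eq_square)
      also have "\<dots> \<le> T ^ 4" by (intro mono) simp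
      finally show ?thesis .
    qed
    ultimately have "(w + 1) * (2 * K + 2) + (4 * w + 2 * K + 5) \<le> T ^ Suc 4"
      using T by (intro add_le_power_Suc) auto
    then show ?thesis by (simp add: numeral_eq_Suc)
  qed
  have C': "w * (4 * w + (w + 1) * (2 * K + 2) + 2 * K + 5) + 2 \<le> T ^ 7"
  proof -
    have "w * (4 * w + (w + 1) * (2 * K + 2) + 2 * K + 5) \<le> T ^ 6"
      by (rule mult_le_power_add[where a = 1 and b = 5]) (use C le1 nonneg T in auto)
    then have "w * (4 * w + (w + 1) * (2 * K + 2) + 2 * K + 5) + 2 \<le> T ^ Suc 6"
      using pow[of 6] T by (intro add_le_power_Suc) auto
    then show ?thesis by (simp add: numeral_eq_Suc)
  qed
  have C'': "P * (w * (4 * w + (w + 1) * (2 * K + 2) + 2 * K + 5) + 2) + 2 \<le> T ^ 10"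
  proof -
    have "P * (w * (4 * w + (w + 1) * (2 * K + 2) + 2 * K + 5) + 2) \<le> T ^ 9"
      by (rule mult_le_power_add[where a = 2 and b = 7]) (use C' le nonneg T in auto)
    then have "P * (w * (4 * w + (w + 1) * (2 * K + 2) + 2 * K + 5) + 2) + 2 \<le> T ^ Suc 9"
      using pow[of 9] T by (intro add_le_power_Suc) auto
    then show ?thesis by (simp add: numeral_eq_Suc)
  qed
  have D: "m * (P * (w * (4 * w + (w + 1) * (2 * K + 2) + 2 * K + 5) + 2) + 2) \<le> T ^ 11"
    using mult_le_power_add[OF le1(3) C'', of 11] nonneg T by simp
  have "m + 12 + m0 + m1 + n + 6 * Q + P * (m0 * (2 * w + 2) + 3)
    + m * (P * (w * (4 * w + (w + 1) * (2 * K + 2) + 2 * K + 5) + 2) + 2)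
    + m1 * (m * (2 * K + 2) + 3) \<le> 64 * T ^ 18"
    using le1 le A' B' D pow[of 18] mono[of 1 18] mono[of 3 18] mono[of 6 18] mono[of 13 18]
      mono[of 10 18] mono[of 11 18] by simp
  also have "\<dots> \<le> T * T ^ 18" using T by (intro mult_right_mono) auto
  also have "\<dots> = T ^ 19" by (simp add: numeral_eq_Suc)
  finally show ?thesis .
qed

lemma one_div_power_le:
  fixes x S :: real
  assumes "0 < x" "1 / x \<le> S"
  shows "1 / x ^ k \<le> S ^ k"
proof -
  have "1 / x ^ k = (1 / x) ^ k" by (simp add: power_one_over)
  also have "\<dots> \<le> S ^ k" using assms by (intro power_mono) auto
  finally show ?thesis .
qed

text \<open>Every quantity is a power of \<open>T = S ^ w\<close>, up to rounding, where
  \<open>S\<close> dominates the parameters. The total \<open>T ^ 19\<close> is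
  \<open>exp (19 * w * ln S)\<close>, and \<open>w \<le> 7 / \<beta> * ln S\<close> gives the
  constant 133 = 19 * 7.\<close>

lemma cnf_eval_quasipolynomial:
  fixes n :: nat and \<phi> :: cnf
  assumes \<phi>: "\<phi> \<noteq> []" and \<mu>: "0 < \<mu>" "\<mu> \<le> 1" and \<gamma>: "0 < \<gamma>" "\<gamma> \<le> 1"
    and \<beta>: "0 < \<beta>" "\<beta> \<le> 1" and \<delta>: "0 < \<delta>" "\<delta> < 1"
  shows "real (steps (cnf_eval n \<mu> \<phi> \<delta> \<gamma> \<beta> \<rho>s))
    \<le> exp (133 / \<beta> * ln (2 + real n + real (cnf_size \<phi>) + 1 / \<mu> + 1 / \<gamma> + ln (1 / \<delta>)) ^ 2)"
proof -
  define w where "w = eval_width (length \<phi>) \<gamma> \<beta>"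
  define m0 where "m0 = learn_samples n w \<mu> \<gamma> \<delta>"
  define m1 where "m1 = test_samples w \<mu> \<gamma> \<delta>"
  define S where "S = 2 + real n + real (cnf_size \<phi>) + 1 / \<mu> + 1 / \<gamma> + ln (1 / \<delta>)"
  define T where "T = S ^ w"
  let ?m = "length \<phi>" and ?K = "cnf_size \<phi>"
  have m: "?m \<ge> 1" using \<phi> by (cases \<phi>) auto
  have w3: "w \<ge> 3" unfolding w_def by (rule eval_width_ge(2)[OF m \<gamma> \<beta>])
  have inv: "1 \<le> 1 / \<mu>" "1 \<le> 1 / \<gamma>" using \<mu> \<gamma> by simp_all
  have ln\<delta>: "0 \<le> ln (1 / \<delta>)" using \<delta> by simp
  have mK: "?m \<le> ?K" by (simp add: cnf_size_def)
  have S4: "4 \<le> S" using inv ln\<delta> by (simp add: S_def)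
  have S_ge: "real n + 1 \<le> S" "real ?K \<le> S" "1 / \<mu> \<le> S" "1 / \<gamma> \<le> S" "ln (1 / \<delta>) \<le> S"
    "4 * real n + 2 + ln (1 / \<delta>) \<le> 4 * S" "2 + ln (1 / \<delta>) \<le> S"
    using inv ln\<delta> by (simp_all add: S_def)
  \<comment> \<open>Here width at least 3 matters: with \<open>S \<ge> 4\<close> it yields
    \<open>T \<ge> 64\<close>.\<close>
  have S3: "S ^ 3 \<le> T" using power_increasing[OF w3, of S] S4 by (simp add: T_def)
  have S2: "S ^ 2 \<le> T" using power_increasing[of 2 w S] w3 S4 by (simp add: T_def)
  have SS: "4 * S \<le> S ^ 2" using S4 by (simp add: power2_eq_square)
  have T64: "64 \<le> T"
    using power_mono[OF S4, of 3] S3 by simp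
  have ST: "S \<le> T" using SS S2 S4 by linarith
  have nT: "2 * real n + 1 \<le> S ^ 2" using S_ge(1) SS S4 by linarith
  have P: "(2 * real n + 1) ^ w \<le> T ^ 2"
  proof -
    have "(2 * real n + 1) ^ w \<le> (S ^ 2) ^ w" using nT by (intro power_mono) auto
    then show ?thesis by (simp add: T_def power_mult[symmetric] mult.commute)
  qed
  have Q: "(2 * real n + 1) ^ (w + 1) \<le> T ^ 3"
  proof -
    have "(2 * real n + 1) ^ w * (2 * real n + 1) \<le> T ^ 3"
      by (rule mult_le_power_add[where a = 2 and b = 1]) (use P nT S2 T64 in auto)
    then show ?thesis by (simp add: mult.commute)
  qed
  have wT: "real w \<le> T"
  proof -
    have "real w \<le> 2 ^ w" using of_nat_less_two_power[of w] by (simp add: less_imp_le)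
    also have "\<dots> \<le> S ^ w" using S4 by (intro power_mono) auto
    finally show ?thesis by (simp add: T_def)
  qed
  have \<mu>w: "1 / \<mu> ^ (k * w) \<le> T ^ k" for k
    using one_div_power_le[OF \<mu>(1) S_ge(3), of "k * w"]
    by (simp add: T_def power_mult[symmetric] mult.commute)
  have \<gamma>2: "1 / \<gamma> ^ 2 \<le> T ^ 1" using one_div_power_le[OF \<gamma>(1) S_ge(4), of 2] S2 by simp
  have m0: "real m0 \<le> T ^ 13"
  proof -
    have "ln (4 * real n + 2) \<le> 4 * real n + 2" using ln_bound[of "4 * real n + 2"] by simp
    moreover have "ln ((4 * real n + 2) / \<delta>) = ln (4 * real n + 2) + ln (1 / \<delta>)"
      using \<delta> by (simp add: ln_div)
    ultimately have ln: "ln ((4 * real n + 2) / \<delta>) \<le> T ^ 1" using S_ge(6) SS S2 by simp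
    have ln0: "0 \<le> ln ((4 * real n + 2) / \<delta>)" using \<delta> by simp
    have "32 * real w \<le> T ^ 2" by (rule mult_le_power_add[where a = 1 and b = 1]) (use T64 wT in auto)
    moreover have "(2 * real n + 1) ^ (2 * w) \<le> T ^ 4"
    proof -
      have "(2 * real n + 1) ^ (2 * w) = ((2 * real n + 1) ^ w) ^ 2" by (rule power_even_eq)
      also have "\<dots> \<le> (T ^ 2) ^ 2" using P by (intro power_mono) auto
      finally show ?thesis by (simp flip: power_mult)
    qed
    ultimately have "32 * real w * (2 * real n + 1) ^ (2 * w) \<le> T ^ 6"
      by (rule mult_le_power_add[where a = 2 and b = 4]) (use T64 in auto)
    moreover have "1 / \<mu> ^ (4 * w) * (1 / \<gamma>\<^sup>2) \<le> T ^ 5"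
      by (rule mult_le_power_add[where a = 4 and b = 1]) (use \<mu>w[of 4] \<gamma>2 \<gamma> T64 in auto)
    ultimately have "32 * real w * (2 * real n + 1) ^ (2 * w) * (1 / \<mu> ^ (4 * w) * (1 / \<gamma>\<^sup>2))
        \<le> T ^ 11"
      by (rule mult_le_power_add[where a = 6 and b = 5]) (use T64 \<mu> \<gamma> in auto)
    then have "32 * real w * (2 * real n + 1) ^ (2 * w) * (1 / \<mu> ^ (4 * w) * (1 / \<gamma>\<^sup>2))
        * ln ((4 * real n + 2) / \<delta>) \<le> T ^ 12"
      by (rule mult_le_power_add[where a = 11 and b = 1]) (use ln ln0 T64 in auto)
    then have "32 * real w * (2 * real n + 1) ^ (2 * w) / (\<mu> ^ (4 * w) * \<gamma>\<^sup>2)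
        * ln ((4 * real n + 2) / \<delta>) \<le> T ^ 12" by simp
    \<comment> \<open>Rounding up adds at most 1, which costs one more power of
      \<open>T\<close>.\<close>
    moreover have "real m0 \<le> 32 * real w * (2 * real n + 1) ^ (2 * w) / (\<mu> ^ (4 * w) * \<gamma>\<^sup>2)
        * ln ((4 * real n + 2) / \<delta>) + 1"
    proof -
      have "0 \<le> 32 * real w * (2 * real n + 1) ^ (2 * w) / (\<mu> ^ (4 * w) * \<gamma>\<^sup>2)
        * ln ((4 * real n + 2) / \<delta>)" using \<mu> \<gamma> ln0 by simp
      then show ?thesis unfolding m0_def learn_samples_def by linarith
    qed
    moreover have "T ^ 12 + 1 \<le> T ^ Suc 12"
      using T64 one_le_power[of T 12] by (intro add_le_power_Suc) auto
    ultimately show ?thesis by (simp add: numeral_eq_Suc)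
  qed
  have m1: "real m1 \<le> T ^ 6"
  proof -
    have "ln (2 / \<delta>) = ln 2 + ln (1 / \<delta>)" using \<delta> by (simp add: ln_div)
    moreover have "ln 2 \<le> (2::real)" using ln_bound[of 2] by simp
    ultimately have ln: "ln (2 / \<delta>) \<le> T ^ 1" using S_ge(7) ST by simp
    have ln0: "0 \<le> ln (2 / \<delta>)" using \<delta> by simp
    have "32 * (1 / \<mu> ^ (2 * w)) \<le> T ^ 3"
      by (rule mult_le_power_add[where a = 1 and b = 2]) (use T64 \<mu>w[of 2] \<mu> in auto)
    then have "32 * (1 / \<mu> ^ (2 * w)) * (1 / \<gamma>\<^sup>2) \<le> T ^ 4"
      by (rule mult_le_power_add[where a = 3 and b = 1]) (use T64 \<gamma>2 \<gamma> in auto)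
    then have "32 * (1 / \<mu> ^ (2 * w)) * (1 / \<gamma>\<^sup>2) * ln (2 / \<delta>) \<le> T ^ 5"
      by (rule mult_le_power_add[where a = 4 and b = 1]) (use T64 ln ln0 in auto)
    moreover have "32 / (\<mu> ^ w * \<gamma>)\<^sup>2 * ln (2 / \<delta>) = 32 * (1 / \<mu> ^ (2 * w)) * (1 / \<gamma>\<^sup>2) * ln (2 / \<delta>)"
      by (simp add: power_mult_distrib power_even_eq)
    ultimately have "32 / (\<mu> ^ w * \<gamma>)\<^sup>2 * ln (2 / \<delta>) \<le> T ^ 5" by (simp only:)
    moreover have "real m1 \<le> 32 / (\<mu> ^ w * \<gamma>)\<^sup>2 * ln (2 / \<delta>) + 1"
    proof -
      have "0 \<le> 32 / (\<mu> ^ w * \<gamma>)\<^sup>2 * ln (2 / \<delta>)" using ln0 by simp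
      then show ?thesis unfolding m1_def test_samples_def by linarith
    qed
    moreover have "T ^ 5 + 1 \<le> T ^ Suc 5"
      using T64 one_le_power[of T 5] by (intro add_le_power_Suc) auto
    ultimately show ?thesis by (simp add: numeral_eq_Suc)
  qed
  have "real (steps (cnf_eval n \<mu> \<phi> \<delta> \<gamma> \<beta> \<rho>s))
      \<le> real (?m + 12 + m0 + m1 + n + 6 * (2 * n + 1) ^ (w + 1)
    + (2 * n + 1) ^ w * (m0 * (2 * w + 2) + 3)
    + ?m * ((2 * n + 1) ^ w * (w * (4 * w + (w + 1) * (2 * ?K + 2) + 2 * ?K + 5) + 2) + 2)
    + m1 * (?m * (2 * ?K + 2) + 3))"
    using steps_cnf_eval[OF w_def m0_def m1_def] by (intro of_nat_mono)
  also have "\<dots> = real ?m + 12 + real m0 + real m1 + real n + 6 * (2 * real n + 1) ^ (w + 1)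
    + (2 * real n + 1) ^ w * (real m0 * (2 * real w + 2) + 3)
    + real ?m * ((2 * real n + 1) ^ w * (real w * (4 * real w + (real w + 1) * (2 * real ?K + 2)
        + 2 * real ?K + 5) + 2) + 2)
    + real m1 * (real ?m * (2 * real ?K + 2) + 3)"
    by (simp only: of_nat_add of_nat_mult of_nat_power of_nat_numeral of_nat_1)
  also have "\<dots> \<le> T ^ 19"
    using T64 P Q wT m0 m1 S_ge ST mK by (intro step_count_le_power) auto
  also have "T ^ 19 = exp (19 * (real w * ln S))"
  proof -
    have "T = exp (real w * ln S)" using S4 by (simp add: T_def exp_of_nat_mult)
    then show ?thesis using exp_of_nat_mult[of 19 "real w * ln S"] by simp
  qed
  also have "\<dots> \<le> exp (133 / \<beta> * ln S ^ 2)"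
  proof -
    have "exp 1 < (4::real)" using exp_le by simp
    then have "exp 1 \<le> S" using S4 by linarith
    then have lnS: "1 \<le> ln S" using S4 by (simp add: ln_ge_iff)
    \<comment> \<open>Each of 4, the number of clauses and 1/\<gamma> is at most \<open>S\<close>,
      so the logarithm is at most \<open>3 * ln S\<close>. The factor \<open>2 / \<beta>\<close>
      makes this 6, and rounding up makes it 7.\<close>
    have "4 * real ?m / \<gamma> = 4 * real ?m * (1 / \<gamma>)" by simp
    also have "\<dots> \<le> S * S * S" using S4 S_ge mK \<gamma> by (intro mult_mono) auto
    finally have "ln (4 * real ?m / \<gamma>) \<le> ln (S * S * S)" using \<phi> \<gamma> S4 by (intro ln_mono) auto
    also have "\<dots> = 3 * ln S" using S4 by (simp add: ln_mult)
    finally have "2 / \<beta> * ln (4 * real ?m / \<gamma>) \<le> 2 / \<beta> * (3 * ln S)"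
      using \<beta> by (intro mult_left_mono) auto
    moreover have "real w \<le> 2 / \<beta> * ln (4 * real ?m / \<gamma>) + 1"
      using w3 unfolding w_def eval_width_def by linarith
    moreover have "1 \<le> ln S / \<beta>" using lnS \<beta> by (simp add: le_divide_eq)
    ultimately have "real w \<le> 7 / \<beta> * ln S" using \<beta> by (simp add: field_simps)
    then have "19 * (real w * ln S) \<le> 19 * (7 / \<beta> * ln S * ln S)"
      using lnS by (intro mult_left_mono mult_right_mono) auto
    then show ?thesis by (simp add: power2_eq_square mult.assoc)
  qed
  finally show ?thesis by (simp add: S_def)
qed

theorem theorem4:
  shows "\<exists>(c::real) (k::nat).
    \<forall>(n::nat) (\<phi>::cnf) (\<mu>::real) (\<gamma>::real) (\<beta>::real) (\<delta>::real) (D::assignment pmf) (w::nat) (m::nat).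
      \<phi> \<noteq> [] \<and> cnf_over n \<phi> \<and>
      0 < \<mu> \<and> \<mu> \<le> 1 \<and> 0 < \<gamma> \<and> \<gamma> \<le> 1 \<and> 0 < \<beta> \<and> \<beta> \<le> 1 \<and> 0 < \<delta> \<and> \<delta> < 1 \<and>
      w = eval_width (length \<phi>) \<gamma> \<beta> \<and>
      m = learn_samples n w \<mu> \<gamma> \<delta> + test_samples w \<mu> \<gamma> \<delta> \<and>
      set_pmf D \<subseteq> cube n \<and>
      correlation_gap n D w \<beta> (1 - \<gamma> * \<mu> ^ w / (8 * real n * (2 * real n + 1) ^ w)) \<longrightarrow>
      (validity D \<phi> \<ge> 1 - \<gamma> * \<mu> ^ w / 8 \<longrightarrow>
         measure_pmf.prob (replicate_pmf m (masked n \<mu> D))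
           {\<rho>s. result (cnf_eval n \<mu> \<phi> \<delta> \<gamma> \<beta> \<rho>s) = Accept} \<ge> 1 - \<delta>) \<and>
      (validity D \<phi> \<le> 1 - \<gamma> \<longrightarrow>
         measure_pmf.prob (replicate_pmf m (masked n \<mu> D))
           {\<rho>s. result (cnf_eval n \<mu> \<phi> \<delta> \<gamma> \<beta> \<rho>s) = Reject} \<ge> 1 - \<delta>) \<and>
      (\<forall>\<rho>s. length \<rho>s = m \<longrightarrow>
         real (steps (cnf_eval n \<mu> \<phi> \<delta> \<gamma> \<beta> \<rho>s))
           \<le> exp (c / \<beta> * ln (2 + real n + real (cnf_size \<phi>) + 1 / \<mu> + 1 / \<gamma> + ln (1 / \<delta>)) ^ k))"
\<comment> \<open>Both witnesses are the constants of the running time bound.\<close>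
proof (rule exI[of _ 133], rule exI[of _ 2], intro allI impI, elim conjE, intro conjI allI impI,
    goal_cases)
  case 1
  then show ?case by (auto intro!: cnf_eval_accepts)
next
  case 2
  then show ?case by (auto intro!: cnf_eval_rejects)
next
  case 3
  then show ?case by (intro cnf_eval_quasipolynomial)
qed

end
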